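(* Let $\chi_1 \pmod{q_1}$ and $\chi_2 \pmod{q_2}$ be primitive Dirichlet characters with $\chi_1\chi_2(-1)=1$ and $q_1q_2>1$, and put $N=q_1q_2$. Let $N=QR$ with $Q,R$ positive integers, $(Q,R)=1$, and assume $q_1\neq 1$ and $q_2\neq R$. Suppose $r,u\in\mathbb{Z}$ with $(r,R)=1$ and $(u,Q)=1$. Then for every $k\in\mathbb{Z}$, $$S_{\chi_1,\chi_2}(\pm 1+Nkur,\ NRku^2)=0$$ (for both choices of sign).
   Context: A primitive character modulo $1$ means the trivial character, $\chi(n)=1$ for all $n$. Let $\psi=\chi_1\overline{\chi_2}$, viewed as a character of $\Gamma_0(N)$ via $\psi\left(\begin{smallmatrix} a&b\\ c&d\end{smallmatrix}\right)=\psi(d)$. Write $e(x)=e^{2\pi i x}$, $\tau(\chi)$ for the Gauss sum, $L(s,\chi)$ for the Dirichlet $L$-function. For $z$ in the upper half-plane define $$F_{\chi_1,\chi_2}(z)=c_1z+c_0+\sum_{n\ge1}\frac{\lambda(n)}{\sqrt n}e(nz),\qquad \lambda(n)=\sum_{ab=n}\chi_1(a)\overline{\chi_2}(b)(b/a)^{1/2},$$ where $c_1=\pi i L(-1,\overline{\chi_2})$ if $q_1=1$ and $c_1=0$ otherwise, and $c_0=\tfrac12L(1,\chi_1)$ if $q_2=1$ and $c_0=0$ otherwise. For $\gamma\in\Gamma_0(N)$ the function $F_{\chi_1,\chi_2}(\gamma z)-\psi(\gamma)F_{\chi_1,\chi_2}(z)$ is independent of $z$; call this constant $\phi_{\chi_1,\chi_2}(\gamma)$,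 and define the newform Dedekind sum $S_{\chi_1,\chi_2}(\gamma)=\frac{\tau(\overline{\chi_1})}{\pi i}\phi_{\chi_1,\chi_2}(\gamma)$. When $q_1\neq1$, $S_{\chi_1,\chi_2}(\gamma)$ depends only on the first column $(a,c)^T$ of $\gamma$, and $S_{\chi_1,\chi_2}(a,c)$ denotes $S_{\chi_1,\chi_2}(\gamma)$ for any $\gamma\in\Gamma_0(N)$ with first column $(a,c)^T$. *)

theory Defs
  imports "HOL-Analysis.Analysis" "HOL-Number_Theory.Cong"
begin

definition dirichlet_char :: "nat \<Rightarrow> (int \<Rightarrow> complex) \<Rightarrow> bool" where
  "dirichlet_char q chi \<longleftrightarrow> q \<ge> 1 \<and>
     (\<forall>n. chi (n + int q) = chi n) \<and>
     (\<forall>m n. chi (m * n) = chi m * chi n) \<and>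
     chi 1 = 1 \<and>
     (\<forall>n. chi n = 0 \<longleftrightarrow> \<not> coprime n (int q))"

definition primitive_char :: "nat \<Rightarrow> (int \<Rightarrow> complex) \<Rightarrow> bool" where
  "primitive_char q chi \<longleftrightarrow> dirichlet_char q chi \<and>
     (\<forall>d::nat. d dvd q \<and> d < q \<longrightarrow>
        \<not> (\<forall>a::int. [a = 1] (mod int d) \<and> coprime a (int q) \<longrightarrow> chi a = 1))"

definition e :: "complex \<Rightarrow> complex" where
  "e x = exp (2 * complex_of_real pi * \<i> * x)"

definition gauss_sum :: "nat \<Rightarrow> (int \<Rightarrow> complex) \<Rightarrow> complex" where
  "gauss_sum q chi = (\<Sum>a<q. chi (int a) * e (of_nat a / of_nat q))"

definition cnj_char :: "(int \<Rightarrow> complex) \<Rightarrow> int \<Rightarrow> complex" where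
  "cnj_char chi = (\<lambda>n. cnj (chi n))"

text \<open>L(1,chi) as the (conditionally convergent) Dirichlet series, for nonprincipal chi.\<close>
definition L_at_1 :: "(int \<Rightarrow> complex) \<Rightarrow> complex" where
  "L_at_1 chi = (\<Sum>n. chi (int n + 1) / of_nat (n + 1))"

text \<open>L(-1,chi) = - B_{2,chi}/2 with B_{2,chi} = q * sum_{a=1}^q chi(a) B_2(a/q),
  B_2(x) = x^2 - x + 1/6 (value of the analytic continuation).\<close>
definition L_at_minus1 :: "nat \<Rightarrow> (int \<Rightarrow> complex) \<Rightarrow> complex" where
  "L_at_minus1 q chi =
     - (of_nat q * (\<Sum>a=1..q. chi (int a) *
          complex_of_real ((real a / real q)^2 - real a / real q + 1/6))) / 2"

definition lam :: "(int \<Rightarrow> complex) \<Rightarrow> (int \<Rightarrow> complex) \<Rightarrow> nat \<Rightarrow> complex" where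
  "lam chi1 chi2 n = (\<Sum>a | a dvd n. chi1 (int a) * cnj (chi2 (int (n div a))) *
       complex_of_real (sqrt (real (n div a) / real a)))"

definition F_fun :: "nat \<Rightarrow> nat \<Rightarrow> (int \<Rightarrow> complex) \<Rightarrow> (int \<Rightarrow> complex) \<Rightarrow> complex \<Rightarrow> complex" where
  "F_fun q1 q2 chi1 chi2 z =
     (if q1 = 1 then complex_of_real pi * \<i> * L_at_minus1 q2 (cnj_char chi2) else 0) * z
     + (if q2 = 1 then L_at_1 chi1 / 2 else 0)
     + (\<Sum>n. lam chi1 chi2 (n + 1) / complex_of_real (sqrt (real (n + 1))) * e (of_nat (n + 1) * z))"

type_synonym mat2 = "int \<times> int \<times> int \<times> int"  (* (a, b, c, d) = [[a,b],[c,d]] *)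

definition in_Gamma0 :: "nat \<Rightarrow> mat2 \<Rightarrow> bool" where
  "in_Gamma0 N \<gamma> = (case \<gamma> of (a, b, c, d) \<Rightarrow> a * d - b * c = 1 \<and> int N dvd c)"

definition moebius_act :: "mat2 \<Rightarrow> complex \<Rightarrow> complex" where
  "moebius_act \<gamma> z = (case \<gamma> of (a, b, c, d) \<Rightarrow>
      (of_int a * z + of_int b) / (of_int c * z + of_int d))"

definition psi_char :: "(int \<Rightarrow> complex) \<Rightarrow> (int \<Rightarrow> complex) \<Rightarrow> mat2 \<Rightarrow> complex" where
  "psi_char chi1 chi2 \<gamma> = (case \<gamma> of (a, b, c, d) \<Rightarrow> chi1 d * cnj (chi2 d))"

definition phi_fun :: "nat \<Rightarrow> nat \<Rightarrow> (int \<Rightarrow> complex) \<Rightarrow> (int \<Rightarrow> complex) \<Rightarrow> mat2 \<Rightarrow> complex" where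
  "phi_fun q1 q2 chi1 chi2 \<gamma> = (THE w. \<forall>z. Im z > 0 \<longrightarrow>
      F_fun q1 q2 chi1 chi2 (moebius_act \<gamma> z) - psi_char chi1 chi2 \<gamma> * F_fun q1 q2 chi1 chi2 z = w)"

definition newform_dedekind_sum :: "nat \<Rightarrow> nat \<Rightarrow> (int \<Rightarrow> complex) \<Rightarrow> (int \<Rightarrow> complex) \<Rightarrow> mat2 \<Rightarrow> complex" where
  "newform_dedekind_sum q1 q2 chi1 chi2 \<gamma> =
     gauss_sum q1 (cnj_char chi1) / (complex_of_real pi * \<i>) * phi_fun q1 q2 chi1 chi2 \<gamma>"

end

theory Submission
  imports Defs "HOL-Real_Asymp.Real_Asymp"
begin

text \<open>
  Up to an additive constant, \<open>F\<close> is an antiderivative of a weight 2 Eisenstein series, which is a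
  finite combination of division values \<open>\<Sum> h(x,y) \<wp>((x z + y)/N)\<close>. Here \<open>h(x,y)\<close> is \<open>0\<close> unless
  \<open>q\<^sub>2\<close> divides \<open>x\<close>, and is then \<open>\<chi>\<^sub>1(x/q\<^sub>2)\<close> times the discrete Fourier transform of the conjugate of
  \<open>\<chi>\<^sub>2\<close> at \<open>y\<close>. The absolutely convergent lattice sum for \<open>\<wp>\<close> makes the action of \<open>SL\<^sub>2(\<int>)\<close>
  visible, so no modularity theorem is needed.
  The matrices in question are, up to sign and a translation \<open>z \<mapsto> z + m\<close>, parabolic elements
  fixing the cusp \<open>r/(Ru)\<close>. Moving this cusp to infinity by some \<open>\<sigma>\<close> in \<open>SL\<^sub>2(\<int>)\<close> replaces \<open>h\<close> by its
  composition with the inverse of \<open>\<sigma>\<close>, whose constant term vanishes because \<open>q\<^sub>2 \<noteq> R\<close>. Hence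
  \<open>F \<circ> \<sigma>\<close> is a constant plus a series in \<open>e(z/N)\<close> without constant term, and the constant
  \<open>F(\<sigma>(z + w)) - F(\<sigma> z)\<close> equals its limit \<open>0\<close> at infinity.
\<close>

subsection \<open>The Lipschitz formula\<close>

text \<open>A bare weight 2 lattice sum converges only conditionally, so a matrix must not be used
  to reorder it. Subtracting the terms of \<open>M\<close> times the lattice gives cubic decay and
  hence an \<open>infsum\<close> invariant under every bijection of the index set. The subtracted
  terms cancel because \<open>h\<close> has total 0; this is one use of
  \<open>q1 \<noteq> 1\<close>, the other being \<open>h 0 y = 0\<close>, the absence of a constant
  term at infinity.

  The numbers in the theorem come from one identity. Let p/c be r/(Ru) in lowest terms, g = gcd(r,
  Ru), sigma a matrix of determinant 1 with first column (p, c), and T the translation by 1. Then P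
  = sigma T^w sigma^(-1) has first column (1 - w p c, -w c^2), and w = -s Q k g^2 makes this s times
  the given column. Matrices of determinant 1 with equal first columns differ by a power of T on the
  right, so s gamma = P T^m. Modulo N the matrix P is upper triangular and unipotent, and its effect
  y - x w p^2 is invisible to \<open>h\<close>, which is supported on q2 | x and has period q2 in
  y.\<close>

lemma linear_form_lower_bound:
  assumes "Im z > 0"
  shows "\<exists>\<delta>>0. \<forall>x y::real. \<delta> * (\<bar>x\<bar> + \<bar>y\<bar>) \<le> norm (of_real x * z + of_real y)"
proof -
  define K where "K = 1 / Im z + 1 + norm z / Im z"
  have K: "K > 0" using assms by (auto simp: K_def add_pos_nonneg)
  have "\<bar>x\<bar> + \<bar>y\<bar> \<le> K * norm (of_real x * z + of_real y)" for x y :: real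
  proof -
    let ?l = "of_real x * z + of_real y :: complex"
    have "\<bar>Im ?l\<bar> \<le> norm ?l" by (rule abs_Im_le_cmod)
    then have "\<bar>x\<bar> * Im z \<le> norm ?l" using assms by (simp add: abs_mult)
    then have x: "\<bar>x\<bar> \<le> norm ?l / Im z" using assms by (simp add: field_simps)
    have "\<bar>y\<bar> = norm (?l - of_real x * z)" by simp
    also have "\<dots> \<le> norm ?l + norm (of_real x * z)" by (rule norm_triangle_ineq4)
    also have "\<dots> = norm ?l + \<bar>x\<bar> * norm z" by (simp add: norm_mult)
    also have "\<dots> \<le> norm ?l + norm ?l / Im z * norm z"
      using x by (intro add_left_mono mult_right_mono) auto
    finally show ?thesis using x by (simp add: K_def algebra_simps)
  qed
  then show ?thesis using K
    by (intro exI[of _ "1/K"]) (auto simp: field_simps)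
qed

lemma summable_on_int_powr:
  assumes "s > 1"
  shows "(\<lambda>n::int. (1 + \<bar>real_of_int n\<bar>) powr (-s)) summable_on UNIV"
proof -
  have "summable (\<lambda>n. real (Suc n) powr (-s))"
    using assms by (subst summable_Suc_iff) (simp add: summable_real_powr_iff)
  then have nat: "(\<lambda>n. (1 + real n) powr (-s)) summable_on UNIV"
    by (intro norm_summable_imp_summable_on) (simp add: add_ac)
  have 1: "(\<lambda>n::int. (1 + \<bar>real_of_int n\<bar>) powr (-s)) summable_on range int"
    using nat by (subst summable_on_reindex) (auto simp: o_def)
  have 2: "(\<lambda>n::int. (1 + \<bar>real_of_int n\<bar>) powr (-s)) summable_on range (\<lambda>n. - int n)"
    using nat by (subst summable_on_reindex) (auto simp: o_def inj_on_def)
  have "x \<in> range int \<union> range (\<lambda>n. - int n)" for x :: int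
    by (cases x rule: int_cases2) auto
  then have "UNIV = range int \<union> range (\<lambda>n. - int n)" by blast
  then show ?thesis using summable_on_union[OF 1 2] by simp
qed

text \<open>The row c = 0 is included because the lattice sums below contain it. A denominator can
  vanish there, so the comparison is made off a finite exceptional set.\<close>

lemma summable_on_int_inverse_square:
  assumes "Im z > 0" "M \<noteq> 0"
  shows "(\<lambda>n::int. norm (1 / (of_int c * z + of_int (d + M * n)) ^ 2)) summable_on UNIV"
proof -
  obtain \<delta> where \<delta>: "\<delta> > 0" "\<And>x y::real. \<delta> * (\<bar>x\<bar> + \<bar>y\<bar>) \<le> norm (of_real x * z + of_real y)"
    using linear_form_lower_bound[OF assms(1)] by metis
  \<comment> \<open>For a = |c| + |d + M n| \<ge> 1 one has 1 + |n| \<le> 2 a + |d| \<le> (2 + |d|)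
    a.\<close>
  define D where "D = 2 + real_of_int \<bar>d\<bar>"
  have bd: "norm (1 / (of_int c * z + of_int (d + M * n)) ^ 2)
             \<le> D\<^sup>2 / \<delta>\<^sup>2 * (1 + \<bar>real_of_int n\<bar>) powr (-2)"
    if "c * z + of_int (d + M * n) \<noteq> 0" for n :: int
  proof -
    let ?l = "of_int c * z + of_int (d + M * n)"
    let ?a = "\<bar>c\<bar> + \<bar>d + M * n\<bar>"
    have l: "\<delta> * of_int ?a \<le> norm ?l"
      using \<delta>(2)[of "of_int c" "of_int (d + M*n)"] by simp
    have "?a \<ge> 1" using that by (smt (verit) mult_eq_0_iff of_int_0_eq_iff add_cancel_right_left of_int_0)
    have "1 + \<bar>n\<bar> \<le> (2 + \<bar>d\<bar>) * ?a"
    proof -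
      have "\<bar>n\<bar> \<le> \<bar>M * n\<bar>" using \<open>M \<noteq> 0\<close> by (simp add: abs_mult mult_le_cancel_right1 int_one_le_iff_zero_less)
      also have "\<dots> \<le> \<bar>d + M * n\<bar> + \<bar>d\<bar>" by linarith
      finally have "1 + \<bar>n\<bar> \<le> ?a + ?a + \<bar>d\<bar> * 1" using \<open>?a \<ge> 1\<close> by linarith
      also have "\<dots> \<le> ?a + ?a + \<bar>d\<bar> * ?a" using \<open>?a \<ge> 1\<close> by (intro add_mono mult_left_mono) auto
      finally show ?thesis by (simp add: algebra_simps)
    qed
    then have "real_of_int (1 + \<bar>n\<bar>) \<le> real_of_int ((2 + \<bar>d\<bar>) * ?a)" by (rule of_int_le_iff[THEN iffD2])
    then have "1 + \<bar>real_of_int n\<bar> \<le> D * of_int ?a"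
      by (simp add: D_def)
    also have "\<dots> \<le> D * (norm ?l / \<delta>)" using l \<delta>(1) by (intro mult_left_mono) (auto simp: field_simps D_def)
    finally have "(1 + \<bar>real_of_int n\<bar>)\<^sup>2 \<le> (D * (norm ?l / \<delta>))\<^sup>2" by (intro power_mono) auto
    then show ?thesis using that \<delta>(1)
      by (simp add: powr_minus powr_numeral norm_divide norm_power field_simps power_mult_distrib)
  qed
  define S where "S = {n. of_int c * z + of_int (d + M * n) = 0}"
  have "finite S"
  proof (rule finite_subset)
    show "S \<subseteq> {- \<bar>d\<bar>..\<bar>d\<bar>}"
    proof
      fix n assume "n \<in> S"
      then have "Im (of_int c * z + of_int (d + M * n)) = 0" "Re (of_int c * z + of_int (d + M * n)) = 0"
        by (simp_all add: S_def)
      then have "c = 0" "of_int c * Re z + of_int (d + M * n) = 0" using assms by simp_all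
      then have "d + M * n = 0" by (simp del: of_int_add of_int_mult)
      then have "\<bar>M * n\<bar> = \<bar>d\<bar>" by linarith
      moreover have "\<bar>n\<bar> \<le> \<bar>M * n\<bar>" using \<open>M \<noteq> 0\<close> by (simp add: abs_mult mult_le_cancel_right1 int_one_le_iff_zero_less)
      ultimately show "n \<in> {- \<bar>d\<bar>..\<bar>d\<bar>}" by auto
    qed
  qed simp
  have "(\<lambda>n. D\<^sup>2 / \<delta>\<^sup>2 * (1 + \<bar>real_of_int n\<bar>) powr (-2)) summable_on UNIV - S"
    by (intro summable_on_cmult_right summable_on_subset[OF summable_on_int_powr[of 2]]) auto
  then have "(\<lambda>n::int. norm (1 / (of_int c * z + of_int (d + M * n)) ^ 2)) summable_on (UNIV - S)"
    by (rule summable_on_comparison_test) (use bd in \<open>auto simp: S_def\<close>)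
  then have "(\<lambda>n::int. norm (1 / (of_int c * z + of_int (d + M * n)) ^ 2)) summable_on (UNIV - S \<union> S)"
    using \<open>finite S\<close> by (intro summable_on_union) auto
  then show ?thesis by simp
qed

text \<open>Logarithmic differentiation of the reflection formula for \<open>Gamma\<close> gives the
  cotangent as a difference of two \<open>Digamma\<close> values; differentiating once more gives
  the squares.\<close>

lemma pi_squared_over_sin_squared:
  assumes "w \<notin> \<int>"
  shows "Polygamma 1 w + Polygamma 1 (1 - w) = (of_real pi / sin (of_real pi * w :: complex))\<^sup>2"
proof -
  have nint: "1 - x \<notin> \<int>" if "x \<notin> \<int>" for x :: complex
    using that by (metis Ints_1 Ints_diff add_diff_cancel_left' diff_add_cancel)
  have np: "x \<notin> \<int>\<^sub>\<le>\<^sub>0" "1 - x \<notin> \<int>\<^sub>\<le>\<^sub>0" if "x \<notin> \<int>" for x :: complex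
    using that nint[OF that] nonpos_Ints_Int by blast+
  have sin: "sin (of_real pi * x) \<noteq> 0" if "x \<notin> \<int>" for x :: complex
    using that sin_eq_0[of "of_real pi * x"] by (auto simp: mult.commute)
  have cot: "Digamma x - Digamma (1 - x) = - of_real pi * cos (of_real pi * x) / sin (of_real pi * x)"
    if x: "x \<notin> \<int>" for x :: complex
  proof -
    have "((\<lambda>x. Gamma x * Gamma (1 - x)) has_field_derivative
            Gamma x * Gamma (1 - x) * (Digamma x - Digamma (1 - x))) (at x)"
      using np[OF x] by (auto intro!: derivative_eq_intros simp: algebra_simps)
    moreover have "((\<lambda>x. of_real pi / sin (of_real pi * x)) has_field_derivative
            - (of_real pi * of_real pi * cos (of_real pi * x)) / sin (of_real pi * x) ^ 2) (at x)"
      using sin[OF x] by (auto intro!: derivative_eq_intros simp: power2_eq_square)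
    ultimately have "Gamma x * Gamma (1 - x) * (Digamma x - Digamma (1 - x)) =
        - (of_real pi * of_real pi * cos (of_real pi * x)) / sin (of_real pi * x) ^ 2"
      using DERIV_unique Gamma_reflection_complex by (metis (no_types, lifting) ext)
    then have "of_real pi / sin (of_real pi * x) * (Digamma x - Digamma (1 - x)) =
        of_real pi / sin (of_real pi * x) * (- of_real pi * cos (of_real pi * x) / sin (of_real pi * x))"
      by (simp add: Gamma_reflection_complex power2_eq_square)
    then show ?thesis using sin[OF x] by (subst (asm) mult_cancel_left) auto
  qed
  have op: "open (UNIV - \<int> :: complex set)" by (simp add: closed_Ints open_Diff)
  have "((\<lambda>x. Digamma x - Digamma (1 - x)) has_field_derivative (Polygamma 1 w + Polygamma 1 (1 - w))) (at w)"
    using np[OF assms] by (auto intro!: derivative_eq_intros)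
  moreover have "((\<lambda>x. - of_real pi * cos (of_real pi * x) / sin (of_real pi * x)) has_field_derivative
       (of_real pi)\<^sup>2 * (sin (of_real pi * w) ^ 2 + cos (of_real pi * w) ^ 2) / sin (of_real pi * w) ^ 2) (at w)"
    using sin[OF assms]
    by (auto intro!: derivative_eq_intros
        simp: power2_eq_square divide_simps simp del: sin_cos_squared_add3)
       (simp add: algebra_simps del: sin_cos_squared_add3)
  then have "((\<lambda>x. Digamma x - Digamma (1 - x)) has_field_derivative
       (of_real pi)\<^sup>2 * (sin (of_real pi * w) ^ 2 + cos (of_real pi * w) ^ 2) / sin (of_real pi * w) ^ 2) (at w)"
    by (rule has_field_derivative_transform_within_open[OF _ op]) (use assms cot in auto)
  ultimately have "Polygamma 1 w + Polygamma 1 (1 - w) =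
       (of_real pi)\<^sup>2 * (sin (of_real pi * w) ^ 2 + cos (of_real pi * w) ^ 2) / sin (of_real pi * w) ^ 2"
    by (rule DERIV_unique)
  then show ?thesis by (simp add: power_divide)
qed

text \<open>The terms n \<ge> 0 form the series of \<open>Polygamma 1 w\<close>. Replacing n by -n -
  1 turns w + n into -(1 - w + n), so the negative terms form that of
  \<open>Polygamma 1 (1 - w)\<close>.\<close>

lemma inverse_square_sum:
  fixes w :: complex
  assumes "Im w > 0"
  shows "((\<lambda>n::int. 1 / (w + of_int n)^2) has_sum (of_real pi / sin (of_real pi * w))\<^sup>2) UNIV"
proof -
  have w: "w \<notin> \<int>" "1 - w \<notin> \<int>" "w \<noteq> 1" using assms by (auto elim!: Ints_cases simp: complex_eq_iff)
  have sm: "(\<lambda>n::int. norm (1 / (w + of_int n)^2)) summable_on UNIV"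
    using summable_on_int_inverse_square[OF assms, of 1 1 0, simplified] by simp
  have 1: "((\<lambda>n::int. 1 / (w + of_int n)^2) has_sum Polygamma 1 w) (range int)"
  proof (subst has_sum_reindex)
    have "summable (\<lambda>n. norm (1 / (w + of_nat n)^2))"
      using summable_on_imp_summable[OF summable_on_reindex[THEN iffD1, OF _ 
          summable_on_subset[OF sm subset_UNIV], of int]] by (simp add: o_def)
    moreover have "(\<lambda>n. 1 / (w + of_nat n)^2) sums Polygamma 1 w"
      using Polygamma_LIMSEQ[of w 1] w nonpos_Ints_Int by (auto simp: inverse_eq_divide power2_eq_square)
    ultimately show "((\<lambda>n::int. 1 / (w + of_int n)^2) \<circ> int has_sum Polygamma 1 w) UNIV"
      using norm_summable_imp_has_sum by (fastforce simp: o_def)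
  qed auto
  have 2: "((\<lambda>n::int. 1 / (w + of_int n)^2) has_sum Polygamma 1 (1 - w)) (range (\<lambda>n. - int n - 1))"
  proof (subst has_sum_reindex)
    have eq: "(w + of_int (- int n - 1))^2 = (1 - w + of_nat n)^2" for n
      by (simp add: power2_eq_square algebra_simps)
    have "summable (\<lambda>n. norm (1 / (1 - w + of_nat n)^2))"
      using summable_on_imp_summable[OF summable_on_reindex[THEN iffD1, OF _ 
          summable_on_subset[OF sm subset_UNIV], of "\<lambda>n. - int n - 1"]] unfolding o_def eq by (simp add: inj_on_def)
    moreover have "(\<lambda>n. 1 / (1 - w + of_nat n)^2) sums Polygamma 1 (1 - w)"
      using Polygamma_LIMSEQ[of "1 - w" 1] w nonpos_Ints_Int by (auto simp: inverse_eq_divide power2_eq_square)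
    ultimately show "((\<lambda>n::int. 1 / (w + of_int n)^2) \<circ> (\<lambda>n. - int n - 1) has_sum Polygamma 1 (1 - w)) UNIV"
      unfolding o_def eq using norm_summable_imp_has_sum by fastforce
  qed (auto simp: inj_on_def)
  have "x \<in> range int \<union> range (\<lambda>n. - int n - 1)" for x :: int
    by (cases x rule: int_cases) auto
  then have U: "range int \<union> range (\<lambda>n. - int n - 1) = UNIV" by blast
  have "range int \<inter> range (\<lambda>n. - int n - 1) = {}" by auto
  from has_sum_Un_disjoint[OF 1 2 this] show ?thesis
    unfolding U pi_squared_over_sin_squared[OF w(1)] .
qed

lemma e_add: "e (x + y) = e x * e y"
  by (simp add: e_def exp_add distrib_left)

lemma norm_e: "norm (e z) = exp (- 2 * pi * Im z)"
  by (simp add: e_def)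

lemma e_of_nat_mult: "e (of_nat n * z) = e z ^ n"
  by (simp add: e_def exp_of_nat_mult[symmetric] algebra_simps)

text \<open>Both sides are rational in q = \<open>e w\<close>: the series is q / (1 - q)^2, and with
  q = u^2 and 2 i sin(pi w) = u - 1/u one gets (1 - q)^2 = -4 q sin(pi w)^2. Combined with
  \<open>inverse_square_sum\<close> this expands the sum of 1/(w + n)^2 in powers of q.\<close>

lemma lipschitz_formula:
  fixes w :: complex
  assumes "Im w > 0"
  shows "((\<lambda>b. of_nat b * e (of_nat b * w)) has_sum (pi / sin (pi * w))\<^sup>2 / (2 * pi * \<i>)\<^sup>2) UNIV"
proof -
  let ?q = "e w"
  have q: "norm ?q < 1" using assms by (simp add: norm_e)
  then have q1: "?q \<noteq> 1" by auto
  have "(\<lambda>n. of_nat (Suc n) * ?q ^ n) sums (1 / (1 - ?q)\<^sup>2)" using q by (rule geometric_deriv_sums)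
  then have "(\<lambda>n. ?q * (of_nat (Suc n) * ?q ^ n)) sums (?q * (1 / (1 - ?q)\<^sup>2))" by (rule sums_mult)
  then have s: "(\<lambda>n. of_nat n * ?q ^ n) sums (?q / (1 - ?q)\<^sup>2)"
    using sums_Suc_iff[of "\<lambda>n. of_nat n * ?q ^ n"] by (simp add: algebra_simps)
  have "summable (\<lambda>n. of_nat (Suc n) * norm ?q ^ n)" 
    using q geometric_deriv_sums[of "norm ?q"] by (auto simp: sums_iff)
  then have "summable (\<lambda>n. norm ?q * (of_nat (Suc n) * norm ?q ^ n))" by (rule summable_mult)
  then have "summable (\<lambda>n. of_nat (Suc n) * norm ?q ^ (Suc n))" by (simp add: algebra_simps)
  then have "summable (\<lambda>n. of_nat n * norm ?q ^ n)" by (subst (asm) summable_Suc_iff) 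
  then have "((\<lambda>n. of_nat n * ?q ^ n) has_sum (?q / (1 - ?q)\<^sup>2)) UNIV"
    using s by (intro norm_summable_imp_has_sum) (simp_all add: norm_mult norm_power)
  moreover have "?q / (1 - ?q)\<^sup>2 = (pi / sin (pi * w))\<^sup>2 / (2 * pi * \<i>)\<^sup>2"
  proof -
    let ?u = "exp (\<i> * (pi * w))"
    have u: "?q = ?u ^ 2" by (simp add: e_def exp_double[symmetric] algebra_simps)
    have s: "sin (pi * w) = (?u - 1 / ?u) / (2 * \<i>)"
      by (simp add: sin_exp_eq exp_minus inverse_eq_divide)
    have "?u \<noteq> 0" "?u^2 \<noteq> 1" using q1 u by auto
    then have "?u - 1 / ?u \<noteq> 0" by (auto simp: field_simps power2_eq_square)
    have "(2 * pi * \<i>)\<^sup>2 * sin (pi * w) ^ 2 * ?q = (pi * (?u ^ 2 - 1)) ^ 2"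
      unfolding s u using \<open>?u \<noteq> 0\<close> by (simp add: field_simps power2_eq_square)
    then have A: "(2 * pi * \<i>)\<^sup>2 * sin (pi * w) ^ 2 * ?q = pi ^ 2 * (1 - ?q) ^ 2"
      unfolding u by (simp add: power2_eq_square algebra_simps)
    have B: "sin (pi * w) \<noteq> 0" "1 - ?q \<noteq> 0" "(2 * pi * \<i>) \<noteq> 0"
      using s \<open>?u - 1 / ?u \<noteq> 0\<close> q1 by auto
    from A have "of_real pi ^ 2 * (4 * sin (pi * w) ^ 2 * ?q + (1 - ?q) ^ 2) = 0"
      by (simp add: power_mult_distrib algebra_simps) (metis add.left_inverse)
    then have "4 * sin (pi * w) ^ 2 * ?q + (1 - ?q) ^ 2 = 0" by simp
    then have "(1 - ?q) ^ 2 = - (4 * sin (pi * w) ^ 2 * ?q)" by (simp add: add_eq_0_iff)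
    moreover have "?q \<noteq> 0" by (simp add: e_def)
    ultimately show ?thesis using B(1)
      by (simp add: power_mult_distrib power_divide)
  qed
  ultimately show ?thesis by (simp add: e_of_nat_mult)
qed

subsection \<open>Lattice sums and the action of the modular group\<close>

definition inv_sq :: "complex \<Rightarrow> int \<Rightarrow> int \<Rightarrow> complex" where
  "inv_sq z x y = 1 / (of_int x * z + of_int y)\<^sup>2"

text \<open>
  With \<open>1/0 = 0\<close> the terms whose denominator vanishes drop out, so this is \<open>\<wp>((x z + y)/M)/M\<^sup>2\<close> off the
  lattice and \<open>0\<close> on it, and the periodicity below holds without exception.
\<close>

definition wp :: "int \<Rightarrow> complex \<Rightarrow> int \<Rightarrow> int \<Rightarrow> complex" where
  "wp M z x y = (\<Sum>\<^sub>\<infinity>(m, n). inv_sq z (x + M * m) (y + M * n) - inv_sq z (M * m) (M * n))"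

definition eisenstein :: "int \<Rightarrow> (int \<Rightarrow> int \<Rightarrow> complex) \<Rightarrow> complex \<Rightarrow> complex" where
  "eisenstein M h z = (\<Sum>(x, y)\<in>{0..<M} \<times> {0..<M}. h x y * wp M z x y)"

definition periodic2 :: "int \<Rightarrow> (int \<Rightarrow> int \<Rightarrow> 'a) \<Rightarrow> bool" where
  "periodic2 M h \<longleftrightarrow> (\<forall>x y. h (x + M) y = h x y \<and> h x (y + M) = h x y)"

lemma periodic_add_mult:
  fixes f :: "int \<Rightarrow> 'a"
  assumes "\<And>x. f (x + M) = f x"
  shows "f (x + M * k) = f x"
proof (induction k rule: int_induct[where k = 0])
  case (step1 i)
  then show ?case using assms[of "x + M * i"] by (simp add: algebra_simps)
next
  case (step2 i)
  then show ?case using assms[of "x + M * (i - 1)"] by (simp add: algebra_simps)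
qed simp

lemma periodic_mod:
  fixes f :: "int \<Rightarrow> 'a"
  assumes "\<And>x. f (x + M) = f x"
  shows "f (x mod M) = f x"
  using periodic_add_mult[of f, OF assms, of "x mod M" "x div M"] by simp

lemma periodic2_add_mult:
  assumes "periodic2 M h"
  shows "h (x + M * m) (y + M * n) = h x y"
proof -
  have "h (x + M * m) (y + M * n) = h x (y + M * n)"
    by (rule periodic_add_mult) (use assms in \<open>simp add: periodic2_def\<close>)
  also have "\<dots> = h x y"
    by (rule periodic_add_mult) (use assms in \<open>simp add: periodic2_def\<close>)
  finally show ?thesis .
qed

lemma periodic2_mod:
  assumes "periodic2 M h"
  shows "h (x mod M) (y mod M) = h x y"
  using periodic2_add_mult[OF assms, of "x mod M" "x div M" "y mod M" "y div M"] by simp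

text \<open>For determinant 1 the substitution is the row vector (x, y) times the inverse of the
  matrix with rows (a, b) and (c, d); weights are always moved in this way.\<close>

lemma periodic2_linear:
  assumes "periodic2 M h"
  shows "periodic2 M (\<lambda>x y. h (x * d - y * c) (y * a - x * b))"
proof -
  have "h ((x + M) * d - y * c) (y * a - (x + M) * b) = h (x * d - y * c) (y * a - x * b)"
       "h (x * d - (y + M) * c) ((y + M) * a - x * b) = h (x * d - y * c) (y * a - x * b)" for x y
    using periodic2_add_mult[OF assms, of "x * d - y * c" d "y * a - x * b" "- b"]
      periodic2_add_mult[OF assms, of "x * d - y * c" "- c" "y * a - x * b" a]
    by (simp_all add: algebra_simps)
  then show ?thesis by (simp add: periodic2_def)
qed

text \<open>A matrix of determinant 1 permutes the pairs of residues modulo M; the witnesses are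
  multiplication by it and by its inverse, reduced modulo M.\<close>

lemma sum_periodic2_SL2:
  fixes P :: "int \<Rightarrow> int \<Rightarrow> 'a :: comm_monoid_add"
  assumes "periodic2 M P" "M > 0" "a * d - b * c = 1"
  shows "(\<Sum>(x, y)\<in>{0..<M} \<times> {0..<M}. P (x * a + y * c) (x * b + y * d)) =
         (\<Sum>(x, y)\<in>{0..<M} \<times> {0..<M}. P x y)"
proof -
  have inv: "((x * a + y * c) * d + (x * b + y * d) * (- c)) = x"
            "((x * a + y * c) * (- b) + (x * b + y * d) * a) = y"
            "(x * d + y * (- c)) * a + (x * (- b) + y * a) * c = x"
            "(x * d + y * (- c)) * b + (x * (- b) + y * a) * d = y" for x y
  proof -
    have "(x * a + y * c) * d + (x * b + y * d) * (- c) = (a * d - b * c) * x" by algebra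
    moreover have "(x * a + y * c) * (- b) + (x * b + y * d) * a = (a * d - b * c) * y" by algebra
    moreover have "(x * d + y * (- c)) * a + (x * (- b) + y * a) * c = (a * d - b * c) * x" by algebra
    moreover have "(x * d + y * (- c)) * b + (x * (- b) + y * a) * d = (a * d - b * c) * y" by algebra
    ultimately show "((x * a + y * c) * d + (x * b + y * d) * (- c)) = x"
            "((x * a + y * c) * (- b) + (x * b + y * d) * a) = y"
            "(x * d + y * (- c)) * a + (x * (- b) + y * a) * c = x"
            "(x * d + y * (- c)) * b + (x * (- b) + y * a) * d = y" using assms(3) by simp_all
  qed
  have m: "((u mod M) * p + (v mod M) * q) mod M = (u * p + v * q) mod M" for u v p q
    by (intro mod_add_cong mod_mult_left_eq)
  show ?thesis
    by (rule sum.reindex_bij_witness[where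
        j = "\<lambda>(x, y). ((x * a + y * c) mod M, (x * b + y * d) mod M)" and
        i = "\<lambda>(x, y). ((x * d + y * (- c)) mod M, (x * (- b) + y * a) mod M)"])
      (use \<open>M > 0\<close> in \<open>auto simp only: m inv periodic2_mod[OF assms(1)] mem_Sigma_iff prod.case
         atLeastLessThan_iff pos_mod_sign pos_mod_bound mod_pos_pos_trivial split: prod.splits\<close>)
qed

lemma moebius_denominator_nonzero:
  assumes "Im z > 0" "(a::int) * d - b * c = 1"
  shows "of_int c * z + of_int d \<noteq> 0"
proof
  assume 0: "of_int c * z + of_int d = 0"
  then have "Im (of_int c * z + of_int d) = 0" by simp
  then have "c = 0" using assms(1) by simp
  with 0 have "d = 0" by simp
  with \<open>c = 0\<close> assms(2) show False by simp
qed

lemma inv_sq_moebius: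
  assumes "Im z > 0" "a * d - b * c = 1"
  shows "inv_sq ((of_int a * z + of_int b) / (of_int c * z + of_int d)) x y =
         (of_int c * z + of_int d)\<^sup>2 * inv_sq z (x * a + y * c) (x * b + y * d)"
proof -
  let ?j = "of_int c * z + of_int d"
  have j: "?j \<noteq> 0" using moebius_denominator_nonzero assms by blast
  have "of_int x * ((of_int a * z + of_int b) / ?j) + of_int y =
        (of_int (x * a + y * c) * z + of_int (x * b + y * d)) / ?j"
    using j by (simp add: divide_simps) (simp add: algebra_simps)
  then show ?thesis unfolding inv_sq_def by (simp add: power_divide)
qed

text \<open>Right multiplication by the matrix permutes all index pairs (m, n), and an unordered sum
  does not notice. Scaling and reindexing of \<open>infsum\<close> hold with or without convergence,
  so no summability has to be shown here.\<close>

lemma wp_moebius: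
  assumes "Im z > 0" "a * d - b * c = 1"
  shows "wp M ((of_int a * z + of_int b) / (of_int c * z + of_int d)) x y =
         (of_int c * z + of_int d)\<^sup>2 * wp M z (x * a + y * c) (x * b + y * d)"
proof -
  let ?j = "of_int c * z + of_int d"
  have inv: "(m * a + n * c) * d + (m * b + n * d) * (- c) = m"
            "(m * a + n * c) * (- b) + (m * b + n * d) * a = n"
            "(m * d + n * (- c)) * a + (m * (- b) + n * a) * c = m"
            "(m * d + n * (- c)) * b + (m * (- b) + n * a) * d = n" for m n
    using assms(2) by algebra+
  have "wp M ((of_int a * z + of_int b) / ?j) x y =
     (\<Sum>\<^sub>\<infinity>(m, n). ?j\<^sup>2 * (inv_sq z (x * a + y * c + M * (m * a + n * c)) (x * b + y * d + M * (m * b + n * d))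
        - inv_sq z (M * (m * a + n * c)) (M * (m * b + n * d))))"
    unfolding wp_def inv_sq_moebius[OF assms] by (simp add: algebra_simps)
  also have "\<dots> = ?j\<^sup>2 * (\<Sum>\<^sub>\<infinity>(m, n). inv_sq z (x * a + y * c + M * (m * a + n * c)) (x * b + y * d + M * (m * b + n * d))
        - inv_sq z (M * (m * a + n * c)) (M * (m * b + n * d)))"
    by (simp add: case_prod_unfold infsum_cmult_right')
  also have "(\<Sum>\<^sub>\<infinity>(m, n). inv_sq z (x * a + y * c + M * (m * a + n * c)) (x * b + y * d + M * (m * b + n * d))
        - inv_sq z (M * (m * a + n * c)) (M * (m * b + n * d))) = wp M z (x * a + y * c) (x * b + y * d)"
    unfolding wp_def
    by (rule infsum_reindex_bij_witness[where
        j = "\<lambda>(m, n). (m * a + n * c, m * b + n * d)" and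
        i = "\<lambda>(m, n). (m * d + n * (- c), m * (- b) + n * a)"])
      (auto simp only: inv split: prod.splits)
  finally show ?thesis .
qed

section \<open>Absolute convergence and periodicity of the regularised lattice sum\<close>

lemma summable_on_inv_sq_line:
  assumes "Im z > 0" "M \<noteq> 0"
  shows "(\<lambda>n. norm (inv_sq z x (y + M * n))) summable_on UNIV" "(\<lambda>n. inv_sq z x (y + M * n)) summable_on UNIV"
proof -
  show "(\<lambda>n. norm (inv_sq z x (y + M * n))) summable_on UNIV"
    using summable_on_int_inverse_square[OF assms] by (simp add: inv_sq_def)
  then show "(\<lambda>n. inv_sq z x (y + M * n)) summable_on UNIV" by (rule abs_summable_summable)
qed

lemma has_sum_diff:
  fixes f g :: "'a \<Rightarrow> 'b :: real_normed_vector"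
  assumes "(f has_sum a) A" "(g has_sum b) A"
  shows "((\<lambda>x. f x - g x) has_sum (a - b)) A"
proof -
  have "((\<lambda>x. - g x) has_sum (- b)) A" using assms(2) by (subst has_sum_uminus) simp
  from has_sum_add[OF assms(1) this] show ?thesis by simp
qed

text \<open>Factoring the difference exposes a - b, which stays fixed for two lattice points at a
  fixed offset. What remains has size K^3, one power better than each term alone.\<close>

lemma norm_inverse_square_diff_le:
  fixes a b :: complex
  assumes "a \<noteq> 0" "b \<noteq> 0" "1 / norm a \<le> K" "1 / norm b \<le> K"
  shows "norm (1 / a\<^sup>2 - 1 / b\<^sup>2) \<le> norm (a - b) * (2 * K ^ 3)"
proof -
  have "0 \<le> 1 / norm a" by simp
  with assms(3) have K: "K \<ge> 0" by linarith
  have "norm (1 / a + 1 / b) \<le> 1 / norm a + 1 / norm b"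
    by (rule order.trans[OF norm_triangle_ineq]) (simp add: norm_divide)
  also have "\<dots> \<le> 2 * K" using assms by linarith
  finally have sum: "norm (1 / a + 1 / b) \<le> 2 * K" .
  have "1 / a\<^sup>2 - 1 / b\<^sup>2 = (b - a) * (1 / a) * (1 / b) * (1 / a + 1 / b)"
    using assms by (simp add: field_simps power2_eq_square)
  also have "norm \<dots> = norm (a - b) * (1 / norm a * (1 / norm b) * norm (1 / a + 1 / b))"
    by (simp add: norm_mult norm_divide norm_minus_commute)
  also have "\<dots> \<le> norm (a - b) * (K * K * (2 * K))"
    using sum assms K by (intro mult_left_mono mult_mono) auto
  finally show ?thesis by (simp add: power3_eq_cube mult_ac)
qed

lemma wp_summable:
  assumes "Im z > 0" "M \<noteq> 0"
  shows "(\<lambda>(m, n). norm (inv_sq z (x + M * m) (y + M * n) - inv_sq z (M * m) (M * n))) summable_on UNIV"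
proof -
  obtain \<delta> where \<delta>: "\<delta> > 0" "\<And>x y::real. \<delta> * (\<bar>x\<bar> + \<bar>y\<bar>) \<le> norm (of_real x * z + of_real y)"
    using linear_form_lower_bound[OF assms(1)] by metis
  define l where "l = (\<lambda>x y. of_int x * z + of_int y)"
  have l: "\<delta> * of_int (\<bar>x\<bar> + \<bar>y\<bar>) \<le> norm (l x y)" for x y
    using \<delta>(2)[of "of_int x" "of_int y"] by (simp add: l_def)
  define D where "D = of_int (2 + \<bar>x\<bar> + \<bar>y\<bar>) / \<delta>"
  have "D > 0" using \<delta> by (simp add: D_def)
  \<comment> \<open>The index pairs for which one of the two denominators vanishes.\<close>
  define S where "S = {p. p = (0, 0) \<or> (x + M * fst p = 0 \<and> y + M * snd p = 0)}"
  have "S \<subseteq> {(0, 0), (- x div M, - y div M)}"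
  proof
    fix p assume "p \<in> S"
    then consider "p = (0,0)" | "x = - (M * fst p)" "y = - (M * snd p)"
      by (auto simp: S_def)
    then show "p \<in> {(0, 0), (- x div M, - y div M)}"
    proof cases
      case 2
      then have "p = (- x div M, - y div M)" using \<open>M \<noteq> 0\<close>
        by (simp add: prod_eq_iff)
      then show ?thesis by simp
    qed simp
  qed
  then have "finite S" by (rule finite_subset) simp
  \<comment> \<open>With A = 1 + |m| + |n|, the product (1 + |m|)(1 + |n|) is at most A^2, so 1/A^3
    is bounded by a product of two powers with exponent -3/2. This separates the double sum into two
    convergent ones.\<close>
  define B where "B = (\<lambda>(m::int, n::int). norm (l x y) * (2 * D ^ 3) *
        ((1 + \<bar>real_of_int m\<bar>) powr (-(3/2)) * (1 + \<bar>real_of_int n\<bar>) powr (-(3/2))))"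
  have bd: "norm (inv_sq z (x + M * m) (y + M * n) - inv_sq z (M * m) (M * n)) \<le> B (m, n)"
    if "(m, n) \<notin> S" for m n
  proof -
    define A where "A = 1 + \<bar>m\<bar> + \<bar>n\<bar>"
    let ?l1 = "l (x + M * m) (y + M * n)" and ?l2 = "l (M * m) (M * n)"
    have "\<bar>m\<bar> \<le> \<bar>M * m\<bar>" "\<bar>n\<bar> \<le> \<bar>M * n\<bar>"
      using \<open>M \<noteq> 0\<close> by (simp_all add: abs_mult mult_le_cancel_right1 int_one_le_iff_zero_less)
    then have A: "A \<le> 1 + \<bar>M * m\<bar> + \<bar>M * n\<bar>" by (simp add: A_def)
    have 1: "\<bar>x + M * m\<bar> + \<bar>y + M * n\<bar> \<ge> 1" using that by (auto simp: S_def; linarith)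
    have 2: "\<bar>M * m\<bar> + \<bar>M * n\<bar> \<ge> 1" 
    proof -
      have "(m, n) \<noteq> (0, 0)" using that by (simp add: S_def)
      then have "m \<noteq> 0 \<or> n \<noteq> 0" by simp
      then have "M * m \<noteq> 0 \<or> M * n \<noteq> 0" using \<open>M \<noteq> 0\<close> by simp
      moreover have "\<bar>a\<bar> + \<bar>b\<bar> \<ge> 1" if "a \<noteq> 0 \<or> b \<noteq> 0" for a b :: int using that by arith
      ultimately show ?thesis by blast
    qed
    let ?v = "\<bar>x\<bar> + \<bar>y\<bar>"
    have "A \<le> (2 + ?v) * t" if "t \<ge> 1" "A \<le> 1 + t + ?v" for t
    proof -
      have "1 + t + ?v * 1 \<le> t + t + ?v * t" using that by (intro add_mono mult_left_mono) auto
      then show ?thesis using that by (simp add: algebra_simps)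
    qed
    note scale = this
    have "A \<le> (2 + ?v) * (\<bar>x + M * m\<bar> + \<bar>y + M * n\<bar>)" using A by (intro scale 1) linarith
    moreover have "A \<le> (2 + ?v) * (\<bar>M * m\<bar> + \<bar>M * n\<bar>)" using A by (intro scale 2) linarith
    moreover have "real_of_int A \<le> D * norm (l u w)" if "A \<le> (2 + ?v) * (\<bar>u\<bar> + \<bar>w\<bar>)" for u w
    proof -
      have "real_of_int A \<le> real_of_int ((2 + ?v) * (\<bar>u\<bar> + \<bar>w\<bar>))" using that by (rule of_int_le_iff[THEN iffD2])
      also have "\<dots> = D * (\<delta> * of_int (\<bar>u\<bar> + \<bar>w\<bar>))" using \<delta>(1) by (simp add: D_def)
      also have "\<dots> \<le> D * norm (l u w)" using l \<open>D > 0\<close> by (intro mult_left_mono) auto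
      finally show ?thesis .
    qed
    ultimately have n1: "real_of_int A \<le> D * norm ?l1" and n2: "real_of_int A \<le> D * norm ?l2" by blast+
    have A0: "real_of_int A > 0" by (simp add: A_def)
    have nz: "?l1 \<noteq> 0" "?l2 \<noteq> 0" using n1 n2 A0 by auto
    have i1: "1 / norm ?l1 \<le> D / of_int A" and i2: "1 / norm ?l2 \<le> D / of_int A"
      using n1 n2 A0 nz by (simp_all add: field_simps)
    have "norm (1 / ?l1\<^sup>2 - 1 / ?l2\<^sup>2) \<le> norm (?l1 - ?l2) * (2 * (D / of_int A) ^ 3)"
      by (rule norm_inverse_square_diff_le) fact+
    also have "?l1 - ?l2 = l x y" by (simp add: l_def distrib_right)
    also have "norm (l x y) * (2 * (D / of_int A) ^ 3) = norm (l x y) * (2 * D ^ 3) * (1 / of_int A ^ 3)"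
      by (simp add: power_divide)
    also have "\<dots> \<le> norm (l x y) * (2 * D ^ 3) * ((1 + \<bar>real_of_int m\<bar>) powr (-(3/2)) * (1 + \<bar>real_of_int n\<bar>) powr (-(3/2)))"
    proof (rule mult_left_mono)
      show "1 / of_int A ^ 3 \<le> (1 + \<bar>real_of_int m\<bar>) powr (-(3/2)) * (1 + \<bar>real_of_int n\<bar>) powr (-(3/2))"
    proof -
      have le: "(1 + \<bar>real_of_int m\<bar>) * (1 + \<bar>real_of_int n\<bar>) \<le> of_int A * of_int A"
        by (intro mult_mono) (auto simp: A_def)
      have "(1 + \<bar>real_of_int m\<bar>) powr (3/2) * (1 + \<bar>real_of_int n\<bar>) powr (3/2) =
          ((1 + \<bar>real_of_int m\<bar>) * (1 + \<bar>real_of_int n\<bar>)) powr (3/2)"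
        by (rule powr_mult[symmetric]; simp)
      also have "\<dots> \<le> (of_int A * of_int A) powr (3/2)"
        using le by (intro powr_mono2) auto
      also have "(of_int A * of_int A) powr (3/2) = real_of_int A ^ 3"
        using A0 by (simp add: powr_mult powr_add[symmetric])
      finally show ?thesis using A0
        by (simp add: powr_minus field_simps)
    qed
    qed (use \<open>D > 0\<close> in simp)
    finally have "norm (1 / ?l1\<^sup>2 - 1 / ?l2\<^sup>2) \<le> B (m, n)"
      by (simp only: B_def prod.case)
    then show ?thesis by (simp only: inv_sq_def l_def)
  qed
  have "(\<lambda>p. B p) summable_on UNIV \<times> UNIV"
  proof (rule summable_on_SigmaI)
    define c where "c = (\<Sum>\<^sub>\<infinity>n::int. (1 + \<bar>real_of_int n\<bar>) powr (-(3/2)))"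
    have "((\<lambda>n::int. (1 + \<bar>real_of_int n\<bar>) powr (-(3/2))) has_sum c) UNIV"
      unfolding c_def by (rule has_sum_infsum[OF summable_on_int_powr]) simp
    then show "((\<lambda>n. B (m, n)) has_sum norm (l x y) * (2 * D ^ 3) * ((1 + \<bar>real_of_int m\<bar>) powr (-(3/2)) * c)) UNIV" for m
      unfolding B_def prod.case by (intro has_sum_cmult_right)
    show "(\<lambda>m. norm (l x y) * (2 * D ^ 3) * ((1 + \<bar>real_of_int m\<bar>) powr (-(3/2)) * c)) summable_on UNIV"
      by (intro summable_on_cmult_right summable_on_cmult_left summable_on_int_powr) simp
  qed (use \<open>D > 0\<close> in \<open>simp add: B_def\<close>)
  then have "B summable_on UNIV - S" by (rule summable_on_subset) auto
  then have "(\<lambda>(m, n). norm (inv_sq z (x + M * m) (y + M * n) - inv_sq z (M * m) (M * n))) summable_on UNIV - S"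
    by (rule summable_on_comparison_test) (use bd in auto)
  then have "(\<lambda>(m, n). norm (inv_sq z (x + M * m) (y + M * n) - inv_sq z (M * m) (M * n))) summable_on (UNIV - S \<union> S)"
    using \<open>finite S\<close> by (intro summable_on_union) auto
  then show ?thesis by simp
qed

lemma wp_summable':
  assumes "Im z > 0" "M \<noteq> 0"
  shows "(\<lambda>(m, n). inv_sq z (x + M * m) (y + M * n) - inv_sq z (M * m) (M * n)) summable_on UNIV"
  by (rule abs_summable_summable) (use wp_summable[OF assms, of x y] in \<open>simp add: case_prod_unfold\<close>)

text \<open>
  Along a line of lattice points the unregularised sum converges absolutely, so a shift of the
  summation index in the inner sum makes the difference vanish.
\<close>

lemma wp_periodic_snd:
  assumes "Im z > 0" "M \<noteq> 0"
  shows "wp M z x (y + M) = wp M z x y"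
proof -
  let ?f = "\<lambda>y (m, n). inv_sq z (x + M * m) (y + M * n) - inv_sq z (M * m) (M * n)"
  define u where "u = (\<lambda>p. ?f (y + M) p - ?f y p)"
  have f: "(?f y has_sum wp M z x y) UNIV" for y
    unfolding wp_def using wp_summable'[OF assms] by (rule has_sum_infsum)
  have "(u has_sum (wp M z x (y + M) - wp M z x y)) (UNIV \<times> UNIV)"
    unfolding u_def UNIV_Times_UNIV by (rule has_sum_diff[OF f f])
  then have "((\<lambda>m::int. 0) has_sum (wp M z x (y + M) - wp M z x y)) UNIV"
  proof (rule has_sum_SigmaD)
    fix m :: int
    have s: "((\<lambda>n. inv_sq z (x + M * m) (y + M * n)) has_sum (\<Sum>\<^sub>\<infinity>n. inv_sq z (x + M * m) (y + M * n))) UNIV"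
      by (rule has_sum_infsum[OF summable_on_inv_sq_line(2)[OF assms]])
    have "bij (\<lambda>n::int. n + 1)" by (rule bij_plus_right)
    from has_sum_reindex_bij_betw[THEN iffD2, OF this s]
    have "((\<lambda>n. inv_sq z (x + M * m) (y + M * (n + 1))) has_sum (\<Sum>\<^sub>\<infinity>n. inv_sq z (x + M * m) (y + M * n))) UNIV" .
    from has_sum_diff[OF this s] show "((\<lambda>n. u (m, n)) has_sum 0) UNIV"
      unfolding u_def by (simp add: distrib_left add_ac)
  qed
  then show ?thesis by (simp add: has_sum_iff)
qed

lemma wp_periodic2:
  assumes "Im z > 0" "M \<noteq> 0"
  shows "periodic2 M (wp M z)"
proof -
  have "wp M z (x + M) y = wp M z x y" for x y
  proof -
    txt \<open>The inversion \<open>z \<mapsto> -1/z\<close> exchanges the two coordinates.\<close>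
    have z: "Im (- 1 / z) > 0" "z \<noteq> 0"
      using assms(1) by (auto simp: Im_divide power2_eq_square intro!: divide_pos_pos add_nonneg_pos)
    have eq: "wp M (- 1 / z) (- y) x = z\<^sup>2 * wp M z x y" for x
      using wp_moebius[OF assms(1), where a = 0 and b = "-1" and c = 1 and d = 0, of M "- y" x] by simp
    have "z\<^sup>2 * wp M z (x + M) y = z\<^sup>2 * wp M z x y"
      using wp_periodic_snd[OF z(1) assms(2), of "- y" x] unfolding eq .
    then show ?thesis using z(2) by simp
  qed
  then show ?thesis using wp_periodic_snd[OF assms] by (simp add: periodic2_def)
qed

text \<open>\<open>wp_moebius\<close> moves the matrix into the arguments of \<open>wp\<close>.
  Writing \<open>h x y\<close> as the transformed weight at the same moved arguments makes the
  summand a function \<open>P\<close> of these arguments only, and the permutation of residues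
  removes the matrix.\<close>

lemma eisenstein_moebius:
  assumes "Im z > 0" "a * d - b * c = 1" "M > 0" "periodic2 M h"
  shows "eisenstein M h ((of_int a * z + of_int b) / (of_int c * z + of_int d)) =
    (of_int c * z + of_int d)\<^sup>2 * eisenstein M (\<lambda>x y. h (x * d - y * c) (y * a - x * b)) z"
proof -
  define P where "P = (\<lambda>x y. h (x * d - y * c) (y * a - x * b) * wp M z x y)"
  have "periodic2 M P"
  proof -
    have W: "wp M z (x + M) y = wp M z x y" "wp M z x (y + M) = wp M z x y" for x y
      using wp_periodic2[OF assms(1), of M] assms(3) by (auto simp: periodic2_def)
    show ?thesis
      using periodic2_linear[OF assms(4), of d c a b] by (simp add: P_def periodic2_def W)
  qed
  have inv: "(x * a + y * c) * d - (x * b + y * d) * c = x" 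
    "(x * b + y * d) * a - (x * a + y * c) * b = y" for x y
    using assms(2) by algebra+
  have "eisenstein M h ((of_int a * z + of_int b) / (of_int c * z + of_int d)) =
     (\<Sum>(x, y)\<in>{0..<M} \<times> {0..<M}. (of_int c * z + of_int d)\<^sup>2 * P (x * a + y * c) (x * b + y * d))"
    unfolding eisenstein_def P_def wp_moebius[OF assms(1,2)] inv by (simp add: mult_ac)
  also have "\<dots> = (of_int c * z + of_int d)\<^sup>2 * (\<Sum>(x, y)\<in>{0..<M} \<times> {0..<M}. P (x * a + y * c) (x * b + y * d))"
    by (simp add: sum_distrib_left case_prod_unfold)
  also have "(\<Sum>(x, y)\<in>{0..<M} \<times> {0..<M}. P (x * a + y * c) (x * b + y * d)) = (\<Sum>(x, y)\<in>{0..<M} \<times> {0..<M}. P x y)"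
    by (rule sum_periodic2_SL2) fact+
  finally show ?thesis unfolding eisenstein_def P_def .
qed

subsection \<open>Lambert series\<close>

lemma has_sum_finite_sum:
  fixes f :: "'a \<Rightarrow> 'b \<Rightarrow> 'c :: real_normed_vector"
  assumes "finite I" "\<And>i. i \<in> I \<Longrightarrow> (f i has_sum s i) A"
  shows "((\<lambda>x. \<Sum>i\<in>I. f i x) has_sum (\<Sum>i\<in>I. s i)) A"
  using assms by (induction I rule: finite_induct) (auto intro!: has_sum_add)

text \<open>The division by c is the integration: as b = n / c, the number n times this coefficient
  is the sum of b B(c, b) over bc = n, which is the coefficient of the Lambert series
  itself.\<close>

definition divisor_coeff :: "(nat \<Rightarrow> nat \<Rightarrow> complex) \<Rightarrow> nat \<Rightarrow> complex" where
  "divisor_coeff B n = (\<Sum>c | c dvd n. B c (n div c) / of_nat c)"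

text \<open>The set of divisors of \<open>0\<close> is infinite, so its sum is \<open>0\<close>.\<close>

lemma divisor_coeff_0 [simp]: "divisor_coeff B 0 = 0"
  by (simp add: divisor_coeff_def)

lemma sum_norm_divisors_le:
  assumes "\<And>c b. norm (B c b :: complex) \<le> K" "n > 0"
  shows "(\<Sum>c | c dvd n. norm (B c (n div c) / of_nat c)) \<le> K * real n"
proof -
  have K: "K \<ge> 0" using norm_ge_zero assms(1) by (rule order.trans)
  have "(\<Sum>c | c dvd n. norm (B c (n div c) / of_nat c)) \<le> (\<Sum>c | c dvd n. K)"
  proof (rule sum_mono)
    fix c assume "c \<in> {c. c dvd n}"
    then have "c > 0" using assms(2) by (auto intro: Nat.gr0I)
    then have "norm (B c (n div c) / of_nat c) \<le> norm (B c (n div c)) / 1"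
      unfolding norm_divide by (intro divide_left_mono) auto
    then show "norm (B c (n div c) / of_nat c) \<le> K" using assms(1)[of c "n div c"] by simp
  qed
  also have "\<dots> = K * card {c. c dvd n}" by simp
  also have "\<dots> \<le> K * real n"
  proof (intro mult_left_mono K of_nat_mono)
    have "card {c. c dvd n} \<le> card {1..n}"
      using assms(2) by (intro card_mono) (auto intro: dvd_imp_le Nat.gr0I simp: Suc_le_eq)
    then show "card {c. c dvd n} \<le> n" by simp
  qed
  finally show ?thesis .
qed

lemma norm_divisor_coeff_le:
  assumes "\<And>c b. norm (B c b) \<le> K"
  shows "norm (divisor_coeff B n) \<le> K * real n"
proof (cases "n = 0")
  case False
  then show ?thesis unfolding divisor_coeff_def
    using sum_norm_divisors_le[OF assms, of n] by (intro order.trans[OF norm_sum]) auto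
qed simp

text \<open>Comparison with the second derivative of the geometric series, whose coefficients are (n
  + 1)(n + 2).\<close>

lemma summable_square_power:
  fixes r :: real
  assumes "0 \<le> r" "r < 1"
  shows "summable (\<lambda>n. real n * real n * r ^ n)"
proof -
  have g: "summable (\<lambda>n. 1 * x ^ n)" if "norm x < 1" for x :: real
    using that by (simp add: summable_geometric)
  have d: "summable (\<lambda>n. diffs (\<lambda>_. 1) n * x ^ n)" if "norm x < 1" for x :: real
    using termdiff_converges[OF that g] by simp
  have "summable (\<lambda>n. diffs (diffs (\<lambda>_. 1)) n * r ^ n)"
    using termdiff_converges[of r 1, OF _ d] assms by simp
  then show ?thesis
  proof (rule summable_comparison_test'[of _ 0])
    show "norm (real n * real n * r ^ n) \<le> diffs (diffs (\<lambda>_. 1)) n * r ^ n" for n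
      using assms by (auto simp: diffs_def abs_mult intro!: mult_right_mono mult_mono)
  qed
qed

lemma divisor_coeff_summable:
  assumes "\<And>c b. norm (B c b) \<le> K" "norm (q::complex) < 1"
  shows "summable (\<lambda>n. norm (of_nat n * divisor_coeff B n * q ^ n))"
    and "summable (\<lambda>n. divisor_coeff B n * q ^ n)"
proof -
  have K: "K \<ge> 0" using norm_ge_zero assms(1) by (rule order.trans)
  have s: "summable (\<lambda>n. K * (real n * real n * norm q ^ n))"
    by (intro summable_mult summable_square_power) (use assms in auto)
  have le: "norm (of_nat n * divisor_coeff B n * q ^ n) \<le> K * (real n * real n * norm q ^ n)" for n
  proof -
    have "norm (of_nat n * divisor_coeff B n * q ^ n) = (real n * norm (divisor_coeff B n)) * norm q ^ n"
      by (simp add: norm_mult norm_power)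
    also have "\<dots> \<le> (real n * (K * real n)) * norm q ^ n"
      by (intro mult_left_mono mult_right_mono norm_divisor_coeff_le assms) auto
    finally show ?thesis by (simp add: mult_ac)
  qed
  show "summable (\<lambda>n. norm (of_nat n * divisor_coeff B n * q ^ n))"
    by (rule summable_comparison_test'[OF s, of 0]) (use le in auto)
  show "summable (\<lambda>n. divisor_coeff B n * q ^ n)"
  proof (rule summable_comparison_test'[OF s, of 0])
    fix n :: nat
    show "norm (divisor_coeff B n * q ^ n) \<le> K * (real n * real n * norm q ^ n)"
    proof (cases "n = 0")
      case False
      have "1 * norm (divisor_coeff B n * q ^ n) \<le> real n * norm (divisor_coeff B n * q ^ n)"
        using False by (intro mult_right_mono) auto
      also have "\<dots> = norm (of_nat n * divisor_coeff B n * q ^ n)" by (simp add: norm_mult)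
      finally show ?thesis using le[of n] by linarith
    qed simp
  qed
qed

text \<open>The pairs (c, b) are grouped by their product n = bc. Absolute convergence is proved on
  the side of the pairs (n, c) with c | n, where the inner sums are finite and polynomially bounded
  in n.\<close>

lemma lambert_series_has_sum:
  assumes B: "\<And>c b. norm (B c b) \<le> K" and q: "norm (q::complex) < 1"
  shows "((\<lambda>(c, b). of_nat b * q ^ (b * c) * B c b) has_sum
      (\<Sum>n. of_nat n * divisor_coeff B n * q ^ n)) ({1..} \<times> {1..})"
proof -
  have K: "K \<ge> 0" using norm_ge_zero B by (rule order.trans)
  define f where "f = (\<lambda>(n, c). of_nat n * (B c (n div c) / of_nat c) * q ^ n)"
  have fin: "finite {c. c dvd n}" if "n \<in> {1..}" for n :: nat using that by simp
  have inner: "((\<lambda>c. f (n, c)) has_sum (of_nat n * divisor_coeff B n * q ^ n)) {c. c dvd n}"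
    if "n \<in> {1..}" for n
  proof (rule has_sum_finiteI[OF fin[OF that]])
    show "of_nat n * divisor_coeff B n * q ^ n = (\<Sum>c | c dvd n. f (n, c))"
      unfolding f_def divisor_coeff_def prod.case sum_distrib_left sum_distrib_right ..
  qed
  have "((\<lambda>n. of_nat n * divisor_coeff B n * q ^ n) has_sum (\<Sum>n. of_nat n * divisor_coeff B n * q ^ n)) UNIV"
    using divisor_coeff_summable(1)[OF B q] summable_sums[OF summable_norm_cancel[OF divisor_coeff_summable(1)[OF B q]]]
    by (rule norm_summable_imp_has_sum)
  then have outer: "((\<lambda>n. of_nat n * divisor_coeff B n * q ^ n) has_sum (\<Sum>n. of_nat n * divisor_coeff B n * q ^ n)) {1..}"
    by (rule has_sum_cong_neutral[THEN iffD1, rotated -1]) (auto simp: Suc_le_eq)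
  have "(\<lambda>p. norm (f p)) summable_on Sigma {1..} (\<lambda>n. {c. c dvd n})"
  proof (rule summable_on_SigmaI)
    fix n :: nat assume n: "n \<in> {1..}"
    show "((\<lambda>c. norm (f (n, c))) has_sum (\<Sum>c | c dvd n. norm (f (n, c)))) {c. c dvd n}"
      by (rule has_sum_finite[OF fin[OF n]])
  next
    have "(\<lambda>n. K * (real n * real n * norm q ^ n)) summable_on UNIV"
      by (intro norm_summable_imp_summable_on)
        (use summable_mult[OF summable_square_power[of "norm q"], of K] q K in \<open>simp add: abs_mult\<close>)
    then have "(\<lambda>n. K * (real n * real n * norm q ^ n)) summable_on {1..}"
      by (rule summable_on_subset) auto
    then show "(\<lambda>n. \<Sum>c | c dvd n. norm (f (n, c))) summable_on {1..}"
    proof (rule summable_on_comparison_test)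
      fix n :: nat assume "n \<in> {1..}"
      have "(\<Sum>c | c dvd n. norm (f (n, c))) = real n * (\<Sum>c | c dvd n. norm (B c (n div c) / of_nat c)) * norm q ^ n"
        unfolding f_def prod.case norm_mult norm_power sum_distrib_left sum_distrib_right by simp
      also have "\<dots> \<le> real n * (K * real n) * norm q ^ n"
        using \<open>n \<in> {1..}\<close> by (intro mult_left_mono mult_right_mono sum_norm_divisors_le[OF B]) auto
      finally show "(\<Sum>c | c dvd n. norm (f (n, c))) \<le> K * (real n * real n * norm q ^ n)"
        by (simp add: mult_ac)
    qed (simp add: sum_nonneg)
  qed simp
  then have "f summable_on Sigma {1..} (\<lambda>n. {c. c dvd n})" by (rule abs_summable_summable)
  with inner outer have "(f has_sum (\<Sum>n. of_nat n * divisor_coeff B n * q ^ n)) (Sigma {1..} (\<lambda>n. {c. c dvd n}))"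
    by (rule has_sum_SigmaI)
  then show ?thesis
  proof (rule has_sum_reindex_bij_witness[where i = "\<lambda>(n, c). (c, n div c)" and j = "\<lambda>(c, b). (b * c, c)", THEN iffD2, rotated -1])
    fix p :: "nat \<times> nat" assume "p \<in> {1..} \<times> {1..}"
    then obtain c b where p: "p = (c, b)" "c > 0" "b > 0" by (cases p) auto
    then show "(case case p of (c, b) \<Rightarrow> (b * c, c) of (n, c) \<Rightarrow> (c, n div c)) = p"
      "(case p of (c, b) \<Rightarrow> (b * c, c)) \<in> Sigma {1..} (\<lambda>n. {c. c dvd n})"
      "f (case p of (c, b) \<Rightarrow> (b * c, c)) = (case p of (c, b) \<Rightarrow> of_nat b * q ^ (b * c) * B c b)"
      by (simp_all add: f_def Suc_le_eq)
  next
    fix p :: "nat \<times> nat" assume "p \<in> Sigma {1..} (\<lambda>n. {c. c dvd n})"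
    then obtain c b where p: "p = (b * c, c)" "b * c > 0" by (cases p) (auto elim!: dvdE simp: mult.commute)
    then show "(case case p of (n, c) \<Rightarrow> (c, n div c) of (c, b) \<Rightarrow> (b * c, c)) = p"
      "(case p of (n, c) \<Rightarrow> (c, n div c)) \<in> {1..} \<times> {1..}"
      by (simp_all add: Suc_le_eq)
  qed simp
qed

section \<open>Fourier coefficients and the integrated series\<close>

text \<open>The sign s treats the rows x = c and x = -c together; y also gets the sign since the row
  of -c at y is the row of c at -y.\<close>

definition fourier_coeff :: "int \<Rightarrow> (int \<Rightarrow> int \<Rightarrow> complex) \<Rightarrow> int \<Rightarrow> nat \<Rightarrow> nat \<Rightarrow> complex" where
  "fourier_coeff M h s c b = (\<Sum>y\<in>{0..<M}. h (s * int c) y * e (of_nat b * of_int (s * y) / of_int M))"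

definition eis_coeff :: "int \<Rightarrow> (int \<Rightarrow> int \<Rightarrow> complex) \<Rightarrow> nat \<Rightarrow> nat \<Rightarrow> complex" where
  "eis_coeff M h c b = fourier_coeff M h 1 c b + fourier_coeff M h (- 1) c b"

definition eis_integral :: "int \<Rightarrow> (int \<Rightarrow> int \<Rightarrow> complex) \<Rightarrow> complex \<Rightarrow> complex" where
  "eis_integral M h z = (\<Sum>n. divisor_coeff (eis_coeff M h) n * e (z / of_int M) ^ n)"

lemma Im_divide_of_int: "Im (z / of_int M) = Im z / of_int M"
  by (metis Im_divide_of_real of_real_of_int_eq)

lemma norm_e_real: "Im z = 0 \<Longrightarrow> norm (e z) = 1"
  by (simp add: norm_e)

lemma periodic2_bounded:
  fixes h :: "int \<Rightarrow> int \<Rightarrow> complex"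
  assumes "periodic2 M h" "M > 0"
  obtains K where "\<And>x y. norm (h x y) \<le> K"
proof -
  define K where "K = (\<Sum>(x, y)\<in>{0..<M} \<times> {0..<M}. norm (h x y))"
  have "norm (h x y) \<le> K" for x y
  proof -
    have "norm (h x y) = (\<lambda>(x, y). norm (h x y)) (x mod M, y mod M)"
      using periodic2_mod[OF assms(1)] by simp
    also have "\<dots> \<le> K" unfolding K_def
      by (rule member_le_sum) (use assms(2) in auto)
    finally show ?thesis .
  qed
  then show ?thesis using that by blast
qed

lemma fourier_coeff_bounded:
  assumes "periodic2 M h" "M > 0"
  obtains K where "\<And>c b. norm (fourier_coeff M h s c b) \<le> K"
proof -
  obtain K where K: "\<And>x y. norm (h x y) \<le> K" using periodic2_bounded[OF assms] by blast
  have "norm (fourier_coeff M h s c b) \<le> (\<Sum>y\<in>{0..<M}. K)" for c b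
    unfolding fourier_coeff_def
    by (rule order.trans[OF norm_sum], rule sum_mono) (simp add: norm_mult norm_e_real Im_divide_of_int K)
  then show ?thesis using that by blast
qed

lemma eis_coeff_bounded:
  assumes "periodic2 M h" "M > 0"
  obtains K where "\<And>c b. norm (eis_coeff M h c b) \<le> K"
proof -
  obtain K1 where "\<And>c b. norm (fourier_coeff M h 1 c b) \<le> K1" using fourier_coeff_bounded[OF assms] by blast
  moreover obtain K2 where "\<And>c b. norm (fourier_coeff M h (- 1) c b) \<le> K2" using fourier_coeff_bounded[OF assms] by blast
  ultimately have "norm (eis_coeff M h c b) \<le> K1 + K2" for c b
    unfolding eis_coeff_def by (intro order.trans[OF norm_triangle_ineq] add_mono)
  then show ?thesis using that by blast
qed

lemma norm_e_less_1:
  assumes "Im z > 0" "(M::int) > 0"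
  shows "norm (e (z / of_int M)) < 1"
  using assms by (simp add: norm_e)

lemma eis_integral_has_field_derivative_aux:
  assumes "Im z > 0" "M > 0" "periodic2 M h"
  shows "(eis_integral M h has_field_derivative 
    2 * pi * \<i> / of_int M * (\<Sum>n. of_nat n * divisor_coeff (eis_coeff M h) n * e (z / of_int M) ^ n)) (at z)"
proof -
  let ?a = "divisor_coeff (eis_coeff M h)"
  obtain K where K: "\<And>c b. norm (eis_coeff M h c b) \<le> K"
    using eis_coeff_bounded assms(3,2) by blast
  let ?q = "e (z / of_int M)"
  have q: "norm ?q < 1" by (rule norm_e_less_1) fact+
  have 1: "((\<lambda>q. \<Sum>n. ?a n * q ^ n) has_field_derivative (\<Sum>n. diffs ?a n * ?q ^ n)) (at ?q)"
    by (rule termdiffs_strong'[OF divisor_coeff_summable(2)[OF K] q])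
  have 2: "((\<lambda>z. e (z / of_int M)) has_field_derivative 2 * pi * \<i> / of_int M * ?q) (at z)"
    using assms(2) unfolding e_def by (auto intro!: derivative_eq_intros)
  have "(\<lambda>n. diffs ?a n * ?q ^ n) sums (\<Sum>n. diffs ?a n * ?q ^ n)"
    by (rule summable_sums[OF termdiff_converges[OF q divisor_coeff_summable(2)[OF K]]])
  then have "(\<lambda>n. ?q * (diffs ?a n * ?q ^ n)) sums (?q * (\<Sum>n. diffs ?a n * ?q ^ n))" by (rule sums_mult)
  then have "(\<lambda>n. of_nat (Suc n) * ?a (Suc n) * ?q ^ Suc n) sums (?q * (\<Sum>n. diffs ?a n * ?q ^ n))"
    by (simp add: diffs_def mult_ac)
  then have "(\<lambda>n. of_nat n * ?a n * ?q ^ n) sums (?q * (\<Sum>n. diffs ?a n * ?q ^ n))"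
    using sums_Suc_iff[of "\<lambda>n. of_nat n * ?a n * ?q ^ n"] by simp
  then have "(\<Sum>n. of_nat n * ?a n * ?q ^ n) = ?q * (\<Sum>n. diffs ?a n * ?q ^ n)" by (simp add: sums_iff)
  with DERIV_chain[OF 1 2] show ?thesis
    by (simp add: eis_integral_def[abs_def] o_def mult_ac)
qed

text \<open>Upwards in the half plane q = e(z/M) tends to 0, and a power series is continuous there.
  Its value at q = 0 is the coefficient at n = 0, which is 0 by
  \<open>divisor_coeff_0\<close>.\<close>

lemma eis_integral_tendsto_0:
  assumes "M > 0" "periodic2 M h"
  shows "((\<lambda>t. eis_integral M h (w + \<i> * of_real t)) \<longlongrightarrow> 0) at_top"
proof -
  let ?a = "divisor_coeff (eis_coeff M h)"
  obtain K where K: "\<And>c b. norm (eis_coeff M h c b) \<le> K"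
    using eis_coeff_bounded assms(2,1) by blast
  have "((\<lambda>t. norm (e ((w + \<i> * of_real t) / of_int M))) \<longlongrightarrow> 0) at_top"
  proof -
    have "((\<lambda>t. exp (- 2 * pi * ((Im w + t) / of_int M))) \<longlongrightarrow> 0) at_top"
      using assms(1) by real_asymp
    then show ?thesis by (simp add: norm_e Im_divide_of_int)
  qed
  then have q: "((\<lambda>t. e ((w + \<i> * of_real t) / of_int M)) \<longlongrightarrow> 0) at_top"
    by (rule tendsto_norm_zero_cancel)
  have "isCont (\<lambda>q. \<Sum>n. ?a n * q ^ n) 0"
    by (rule DERIV_isCont[OF termdiffs_strong'[OF divisor_coeff_summable(2)[OF K], of 1]]) auto
  from isCont_tendsto_compose[OF this q] show ?thesis
    by (simp add: eis_integral_def)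
qed

subsection \<open>Expansion of the Eisenstein series\<close>

definition row_sum :: "int \<Rightarrow> complex \<Rightarrow> int \<Rightarrow> int \<Rightarrow> complex" where
  "row_sum M z x y = (\<Sum>\<^sub>\<infinity>n. inv_sq z x (y + M * n))"

definition row :: "int \<Rightarrow> (int \<Rightarrow> int \<Rightarrow> complex) \<Rightarrow> complex \<Rightarrow> int \<Rightarrow> complex" where
  "row M h z x = (\<Sum>y\<in>{0..<M}. h x y * row_sum M z x y)"

lemma row_sum_has_sum:
  assumes "Im z > 0" "M \<noteq> 0"
  shows "((\<lambda>n. inv_sq z x (y + M * n)) has_sum row_sum M z x y) UNIV"
  unfolding row_sum_def by (rule has_sum_infsum[OF summable_on_inv_sq_line(2)[OF assms]])

lemma row_sum_uminus:
  assumes "Im z > 0" "M \<noteq> 0"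
  shows "row_sum M z (- x) y = row_sum M z x (- y)"
proof -
  have "inv_sq z (- x) (y + M * (- n)) = inv_sq z x (- y + M * n)" for n
  proof -
    have "of_int (- x) * z + of_int (y + M * (- n)) = - (of_int x * z + of_int (- y + M * n))"
      by (simp add: algebra_simps)
    then show ?thesis unfolding inv_sq_def by (simp only: power2_minus)
  qed
  moreover have "bij (\<lambda>n::int. - n)" by (rule bij_uminus)
  from has_sum_reindex_bij_betw[THEN iffD2, OF this row_sum_has_sum[OF assms]]
  have "((\<lambda>n. inv_sq z (- x) (y + M * (- n))) has_sum row_sum M z (- x) y) UNIV" .
  ultimately have "((\<lambda>n. inv_sq z x (- y + M * n)) has_sum row_sum M z (- x) y) UNIV" by simp
  then show ?thesis using has_sum_unique row_sum_has_sum[OF assms] by blast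
qed

lemma row_sum_expansion:
  assumes "Im z > 0" "M > 0" "c > 0"
  shows "((\<lambda>b. (2 * pi * \<i> / of_int M)\<^sup>2 * (of_nat b * e (z / of_int M) ^ (b * c) * e (of_nat b * of_int y / of_int M)))
            has_sum row_sum M z (int c) y) {1..}"
proof -
  \<comment> \<open>This choice makes the row a multiple of the one in
    \<open>inverse_square_sum\<close>: c z + y + M n = M (w + n).\<close>
  define w where "w = (of_nat c * z + of_int y) / of_int M"
  have w: "Im w > 0" using assms by (simp add: w_def Im_divide_of_int)
  have "of_int (int c) * z + of_int (y + M * n) = of_int M * (w + of_int n)" for n
    using assms(2) by (simp add: w_def field_simps)
  then have "inv_sq z (int c) (y + M * n) = 1 / (of_int M)\<^sup>2 * (1 / (w + of_int n)\<^sup>2)" for n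
    unfolding inv_sq_def by (simp only: power_mult_distrib) simp
  then have "((\<lambda>n. inv_sq z (int c) (y + M * n)) has_sum (1 / (of_int M)\<^sup>2 * (of_real pi / sin (of_real pi * w))\<^sup>2)) UNIV"
    using has_sum_cmult_right[OF inverse_square_sum[OF w], of "1 / (of_int M)\<^sup>2"] by simp
  then have R: "row_sum M z (int c) y = 1 / (of_int M)\<^sup>2 * (of_real pi / sin (of_real pi * w))\<^sup>2"
    using has_sum_unique row_sum_has_sum[OF assms(1)] assms(2) by (metis less_irrefl)
  have eb: "e (of_nat b * w) = e (z / of_int M) ^ (b * c) * e (of_nat b * of_int y / of_int M)" for b
    unfolding w_def e_of_nat_mult[symmetric] e_add[symmetric] by (simp add: add_divide_distrib distrib_left mult_ac)
  have "((\<lambda>b. (2 * pi * \<i> / of_int M)\<^sup>2 * (of_nat b * e (of_nat b * w))) has_sum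
          (2 * pi * \<i> / of_int M)\<^sup>2 * ((pi / sin (pi * w))\<^sup>2 / (2 * pi * \<i>)\<^sup>2)) UNIV"
    by (rule has_sum_cmult_right[OF lipschitz_formula[OF w]])
  also have "(2 * pi * \<i> / of_int M)\<^sup>2 * ((pi / sin (pi * w))\<^sup>2 / (2 * pi * \<i>)\<^sup>2) = row_sum M z (int c) y"
    unfolding R by (simp add: power_divide)
  finally have "((\<lambda>b. (2 * pi * \<i> / of_int M)\<^sup>2 * (of_nat b * e (z / of_int M) ^ (b * c) * e (of_nat b * of_int y / of_int M)))
            has_sum row_sum M z (int c) y) UNIV" unfolding eb by (simp only: mult.assoc)
  \<comment> \<open>The term b = 0 is 0 and may be dropped, to match the index set of the Lambert
    series.\<close>
  then show ?thesis
    by (rule has_sum_cong_neutral[THEN iffD1, rotated -1]) (auto simp: Suc_le_eq)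
qed

lemma row_expansion:
  assumes "Im z > 0" "M > 0" "c > 0" "s \<in> {1, -1}"
  shows "((\<lambda>b. (2 * pi * \<i> / of_int M)\<^sup>2 * (of_nat b * e (z / of_int M) ^ (b * c) * fourier_coeff M h s c b))
            has_sum row M h z (s * int c)) {1..}"
proof -
  have "row_sum M z (s * int c) y = row_sum M z (int c) (s * y)" for y
    using assms(2,4) row_sum_uminus[OF assms(1)] by auto
  then have "row M h z (s * int c) = (\<Sum>y\<in>{0..<M}. h (s * int c) y * row_sum M z (int c) (s * y))"
    by (simp add: row_def)
  moreover have "((\<lambda>b. \<Sum>y\<in>{0..<M}. h (s * int c) y *
         ((2 * pi * \<i> / of_int M)\<^sup>2 * (of_nat b * e (z / of_int M) ^ (b * c) * e (of_nat b * of_int (s * y) / of_int M))))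
       has_sum (\<Sum>y\<in>{0..<M}. h (s * int c) y * row_sum M z (int c) (s * y))) {1..}"
    by (intro has_sum_finite_sum has_sum_cmult_right row_sum_expansion assms) simp
  moreover have "(\<Sum>y\<in>{0..<M}. h (s * int c) y *
         ((2 * pi * \<i> / of_int M)\<^sup>2 * (of_nat b * e (z / of_int M) ^ (b * c) * e (of_nat b * of_int (s * y) / of_int M))))
      = (2 * pi * \<i> / of_int M)\<^sup>2 * (of_nat b * e (z / of_int M) ^ (b * c) * fourier_coeff M h s c b)" for b
    unfolding fourier_coeff_def sum_distrib_left by (intro sum.cong refl) (simp only: mult_ac)
  ultimately show ?thesis by simp
qed

lemma rows_half_sum:
  assumes "Im z > 0" "M > 0" "periodic2 M h" "s \<in> {1, -1}"
  shows "(row M h z has_sum ((2 * pi * \<i> / of_int M)\<^sup>2 *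
     (\<Sum>n. of_nat n * divisor_coeff (fourier_coeff M h s) n * e (z / of_int M) ^ n))) ((\<lambda>c. s * int c) ` {1..})"
proof -
  obtain K where K: "\<And>c b. norm (fourier_coeff M h s c b) \<le> K"
    using fourier_coeff_bounded assms(3,2) by blast
  have "((\<lambda>c. row M h z (s * int c)) has_sum ((2 * pi * \<i> / of_int M)\<^sup>2 *
     (\<Sum>n. of_nat n * divisor_coeff (fourier_coeff M h s) n * e (z / of_int M) ^ n))) {1..}"
  proof (rule has_sum_SigmaD)
    show "((\<lambda>p. (2 * pi * \<i> / of_int M)\<^sup>2 * (case p of (c, b) \<Rightarrow> of_nat b * e (z / of_int M) ^ (b * c) * fourier_coeff M h s c b))
     has_sum ((2 * pi * \<i> / of_int M)\<^sup>2 *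
     (\<Sum>n. of_nat n * divisor_coeff (fourier_coeff M h s) n * e (z / of_int M) ^ n))) ({1..} \<times> {1..})"
      by (intro has_sum_cmult_right lambert_series_has_sum[OF K] norm_e_less_1 assms)
    show "((\<lambda>b. (2 * pi * \<i> / of_int M)\<^sup>2 * (case (c, b) of (c, b) \<Rightarrow> of_nat b * e (z / of_int M) ^ (b * c) * fourier_coeff M h s c b))
      has_sum row M h z (s * int c)) {1..}" if "c \<in> {1..}" for c
      unfolding prod.case by (rule row_expansion) (use assms that in auto)
  qed
  moreover have "inj_on (\<lambda>c. s * int c) {1..}" using assms(4) by (auto simp: inj_on_def)
  ultimately show ?thesis by (subst has_sum_reindex) (simp_all add: o_def)
qed

text \<open>Only the rows x > 0 and x < 0 have a q-expansion without constant term; the hypothesis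
  on \<open>h 0 y\<close> removes the row x = 0, which would contribute a constant.\<close>

lemma rows_sum:
  assumes "Im z > 0" "M > 0" "periodic2 M h" "\<And>y. h 0 y = 0"
  shows "(row M h z has_sum ((2 * pi * \<i> / of_int M)\<^sup>2 *
     (\<Sum>n. of_nat n * divisor_coeff (eis_coeff M h) n * e (z / of_int M) ^ n))) UNIV"
proof -
  let ?S = "\<lambda>s. \<Sum>n. of_nat n * divisor_coeff (fourier_coeff M h s) n * e (z / of_int M) ^ n"
  have sm: "summable (\<lambda>n. of_nat n * divisor_coeff (fourier_coeff M h s) n * e (z / of_int M) ^ n)" for s
  proof -
    obtain K where K: "\<And>c b. norm (fourier_coeff M h s c b) \<le> K"
      using fourier_coeff_bounded assms(3,2) by blast
    show ?thesis by (rule summable_norm_cancel[OF divisor_coeff_summable(1)[OF K norm_e_less_1[OF assms(1,2)]]])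
  qed
  have coeff: "divisor_coeff (eis_coeff M h) n = divisor_coeff (fourier_coeff M h 1) n + divisor_coeff (fourier_coeff M h (- 1)) n" for n
    unfolding divisor_coeff_def eis_coeff_def by (simp add: sum.distrib add_divide_distrib)
  have S: "(\<Sum>n. of_nat n * divisor_coeff (eis_coeff M h) n * e (z / of_int M) ^ n) = ?S 1 + ?S (- 1)"
    unfolding coeff suminf_add[OF sm sm] by (simp add: algebra_simps)
  let ?P = "(\<lambda>c. 1 * int c) ` {1..}" and ?N = "(\<lambda>c. - 1 * int c) ` {1..}"
  have "(row M h z has_sum ((2 * pi * \<i> / of_int M)\<^sup>2 * ?S 1 + (2 * pi * \<i> / of_int M)\<^sup>2 * ?S (- 1))) (?P \<union> ?N)"
    by (intro has_sum_Un_disjoint rows_half_sum assms) auto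
  moreover have "x \<in> ?P \<union> ?N" if "x \<noteq> 0" for x
  proof (cases "x > 0")
    case True
    then show ?thesis by (intro UnI1 image_eqI[of _ _ "nat x"]) auto
  next
    case False
    then show ?thesis using that by (intro UnI2 image_eqI[of _ _ "nat (- x)"]) auto
  qed
  then have "row M h z x = 0" if "x \<notin> ?P \<union> ?N" for x
    using that assms(4) by (cases "x = 0") (auto simp: row_def)
  ultimately have "(row M h z has_sum ((2 * pi * \<i> / of_int M)\<^sup>2 * ?S 1 + (2 * pi * \<i> / of_int M)\<^sup>2 * ?S (- 1))) UNIV"
    by (elim has_sum_cong_neutral[THEN iffD1, rotated -1]) auto
  then show ?thesis unfolding S by (simp only: distrib_left)
qed

text \<open>For fixed m the subtracted terms sum over n to a value independent of (x, y). It is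
  therefore multiplied by the total of \<open>h\<close>, which is 0, and only the plain row sums
  remain.\<close>

lemma eisenstein_rows:
  assumes "Im z > 0" "M > 0" "(\<Sum>(x, y)\<in>{0..<M} \<times> {0..<M}. h x y) = 0" "periodic2 M h"
  shows "((\<lambda>m. \<Sum>x\<in>{0..<M}. row M h z (x + M * m)) has_sum eisenstein M h z) UNIV"
proof -
  have M: "M \<noteq> 0" using assms(2) by simp
  let ?B = "{0..<M} \<times> {0..<M}"
  define f where "f = (\<lambda>(m, n). \<Sum>(x, y)\<in>?B. h x y * (inv_sq z (x + M * m) (y + M * n) - inv_sq z (M * m) (M * n)))"
  have "(f has_sum eisenstein M h z) UNIV"
  proof -
    have "((\<lambda>(m, n). inv_sq z (x + M * m) (y + M * n) - inv_sq z (M * m) (M * n)) has_sum wp M z x y) UNIV" for x y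
      unfolding wp_def by (rule has_sum_infsum[OF wp_summable'[OF assms(1) M]])
    then have "((\<lambda>p. \<Sum>v\<in>?B. (case v of (x, y) \<Rightarrow> h x y * (case p of (m, n) \<Rightarrow> inv_sq z (x + M * m) (y + M * n) - inv_sq z (M * m) (M * n))))
       has_sum (\<Sum>v\<in>?B. case v of (x, y) \<Rightarrow> h x y * wp M z x y)) UNIV"
      by (intro has_sum_finite_sum) (auto intro!: has_sum_cmult_right)
    then show ?thesis by (simp add: eisenstein_def f_def case_prod_unfold)
  qed
  then have "(f has_sum eisenstein M h z) (UNIV \<times> UNIV)" by simp
  then show ?thesis
  proof (rule has_sum_SigmaD)
    fix m :: int
    have "((\<lambda>n. f (m, n)) has_sum (\<Sum>v\<in>?B. case v of (x, y) \<Rightarrow> h x y * (row_sum M z (x + M * m) y - row_sum M z (M * m) 0))) UNIV"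
      unfolding f_def prod.case
      using row_sum_has_sum[OF assms(1) M, of "M * m" 0]
      by (intro has_sum_finite_sum) (auto intro!: has_sum_cmult_right has_sum_diff row_sum_has_sum assms M)
    also have "(\<Sum>v\<in>?B. case v of (x, y) \<Rightarrow> h x y * (row_sum M z (x + M * m) y - row_sum M z (M * m) 0)) =
       (\<Sum>(x, y)\<in>?B. h x y * row_sum M z (x + M * m) y) - (\<Sum>(x, y)\<in>?B. h x y) * row_sum M z (M * m) 0"
      by (simp add: case_prod_unfold sum_subtractf right_diff_distrib sum_distrib_right)
    also have "\<dots> = (\<Sum>x\<in>{0..<M}. \<Sum>y\<in>{0..<M}. h x y * row_sum M z (x + M * m) y)"
      by (simp add: assms(3) sum.cartesian_product)
    also have "\<dots> = (\<Sum>x\<in>{0..<M}. row M h z (x + M * m))"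
      unfolding row_def using periodic2_add_mult[OF assms(4), of _ m _ 0] by simp
    finally show "((\<lambda>n. f (m, n)) has_sum (\<Sum>x\<in>{0..<M}. row M h z (x + M * m))) UNIV" .
  qed
qed

text \<open>One family of rows is summed twice: over all x by \<open>rows_sum\<close>, and grouped
  as x = M m + residue by \<open>eisenstein_rows\<close>.\<close>

theorem eisenstein_expansion:
  assumes "Im z > 0" "M > 0" "periodic2 M h" "\<And>y. h 0 y = 0"
    and "(\<Sum>(x, y)\<in>{0..<M} \<times> {0..<M}. h x y) = 0"
  shows "eisenstein M h z = (2 * pi * \<i> / of_int M)\<^sup>2 *
     (\<Sum>n. of_nat n * divisor_coeff (eis_coeff M h) n * e (z / of_int M) ^ n)" (is "_ = ?S")
proof -
  have "(row M h z has_sum ?S) UNIV" by (rule rows_sum) (fact assms)+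
  then have "((\<lambda>(m, x). row M h z (x + M * m)) has_sum ?S) (UNIV \<times> {0..<M})"
    by (rule has_sum_reindex_bij_witness[where i = "\<lambda>x. (x div M, x mod M)" and j = "\<lambda>(m, x). x + M * m",
          THEN iffD2, rotated -1])
      (use assms(2) in auto)
  then have "((\<lambda>m. \<Sum>x\<in>{0..<M}. row M h z (x + M * m)) has_sum ?S) UNIV"
    by (rule has_sum_SigmaD) (auto intro: has_sum_finite)
  then show ?thesis using has_sum_unique eisenstein_rows[OF assms(1,2,5,3)] by blast
qed

corollary eis_integral_has_field_derivative:
  assumes "Im z > 0" "M > 0" "periodic2 M h" "\<And>y. h 0 y = 0"
    and "(\<Sum>(x, y)\<in>{0..<M} \<times> {0..<M}. h x y) = 0"
  shows "(eis_integral M h has_field_derivative of_int M / (2 * pi * \<i>) * eisenstein M h z) (at z)"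
  by (rule DERIV_cong[OF eis_integral_has_field_derivative_aux[OF assms(1-3)]])
    (use assms(2) in \<open>simp add: eisenstein_expansion[OF assms] power2_eq_square\<close>)

subsection \<open>Invariance of the Eisenstein integral under parabolic elements\<close>

lemma Im_moebius_pos:
  assumes "Im z > 0" "(a::int) * d - b * c = 1"
  shows "Im ((of_int a * z + of_int b) / (of_int c * z + of_int d)) > 0"
proof -
  let ?n = "of_int a * z + of_int b" and ?j = "of_int c * z + of_int d"
  have j: "?j \<noteq> 0" by (rule moebius_denominator_nonzero) fact+
  have "real_of_int a * of_int d - of_int b * of_int c = 1"
    using arg_cong[OF assms(2), of real_of_int] by simp
  then have "Im z = Im z * (of_int a * of_int d - of_int b * of_int c)" by simp
  also have "\<dots> = Im ?n * Re ?j - Re ?n * Im ?j" by (simp add: algebra_simps)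
  finally have "Im z = Im ?n * Re ?j - Re ?n * Im ?j" .
  then have "Im (?n / ?j) = Im z / (norm ?j)\<^sup>2"
    by (simp only: Im_divide cmod_power2)
  with j assms(1) show ?thesis by simp
qed

lemma constant_on_upper_half_plane:
  assumes "\<And>z. Im z > 0 \<Longrightarrow> (f has_field_derivative 0) (at z)"
  obtains C where "\<And>z. Im z > 0 \<Longrightarrow> f z = (C :: complex)"
  using has_field_derivative_zero_constant[OF convex_halfspace_Im_gt[of 0], of f] assms
    has_field_derivative_at_within by (metis mem_Collect_eq)

text \<open>In weight 2 the factor j^2 of \<open>eisenstein_moebius\<close> cancels the derivative
  1/j^2 of the Moebius map, so both sides have the same derivative on a convex region. The
  assumption on \<open>h (- (y * c)) (y * a)\<close> says \<open>h' 0 y = 0\<close>: no constant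
  term at the cusp a/c.\<close>

lemma eis_integral_moebius:
  assumes "M > 0" "periodic2 M h" "\<And>y. h 0 y = 0"
    and "(\<Sum>(x, y)\<in>{0..<M} \<times> {0..<M}. h x y) = 0"
    and "a * d - b * c = 1" "\<And>y. h (- (y * c)) (y * a) = 0"
  defines "h' \<equiv> \<lambda>x y. h (x * d - y * c) (y * a - x * b)"
  obtains C where "\<And>z. Im z > 0 \<Longrightarrow>
    eis_integral M h ((of_int a * z + of_int b) / (of_int c * z + of_int d)) = eis_integral M h' z + C"
  and "periodic2 M h'" and "\<And>y. h' 0 y = 0"
  and "(\<Sum>(x, y)\<in>{0..<M} \<times> {0..<M}. h' x y) = 0"
proof -
  have per: "periodic2 M h'"
    unfolding h'_def by (rule periodic2_linear) fact
  have zero: "h' 0 y = 0" for y using assms(6) by (simp add: h'_def)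
  have det: "d * a - (- b) * (- c) = 1" using assms(5) by (simp add: mult.commute)
  have sum: "(\<Sum>(x, y)\<in>{0..<M} \<times> {0..<M}. h' x y) = 0"
    using sum_periodic2_SL2[OF assms(2,1) det] assms(4) by (simp add: h'_def)
  let ?\<sigma> = "\<lambda>z. (of_int a * z + of_int b) / (of_int c * z + of_int d)"
  have "((\<lambda>z. eis_integral M h (?\<sigma> z) - eis_integral M h' z) has_field_derivative 0) (at z)" if z: "Im z > 0" for z
  proof -
    let ?j = "of_int c * z + of_int d"
    have j: "?j \<noteq> 0" using z assms(5) by (rule moebius_denominator_nonzero)
    have det': "of_int a * of_int d - of_int b * of_int c = (1 :: complex)"
      using arg_cong[OF assms(5), of of_int] by simp
    have "(?\<sigma> has_field_derivative (of_int a * ?j - (of_int a * z + of_int b) * of_int c) / (?j * ?j)) (at z)"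
      using j by (auto intro!: derivative_eq_intros)
    also have "of_int a * ?j - (of_int a * z + of_int b) * of_int c = of_int a * of_int d - of_int b * of_int c"
      by (simp add: algebra_simps)
    finally have \<sigma>: "(?\<sigma> has_field_derivative 1 / ?j\<^sup>2) (at z)" by (simp only: det' power2_eq_square)
    have "(eis_integral M h has_field_derivative of_int M / (2 * pi * \<i>) * eisenstein M h (?\<sigma> z)) (at (?\<sigma> z))"
      using Im_moebius_pos[OF z assms(5)] assms(1-4) by (rule eis_integral_has_field_derivative)
    from DERIV_chain2[OF this \<sigma>]
    have "((\<lambda>z. eis_integral M h (?\<sigma> z)) has_field_derivative
       of_int M / (2 * pi * \<i>) * eisenstein M h (?\<sigma> z) * (1 / ?j\<^sup>2)) (at z)" .
    also have "of_int M / (2 * pi * \<i>) * eisenstein M h (?\<sigma> z) * (1 / ?j\<^sup>2) = of_int M / (2 * pi * \<i>) * eisenstein M h' z"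
      unfolding eisenstein_moebius[OF z assms(5,1,2)] h'_def using j by simp
    finally show ?thesis
      using eis_integral_has_field_derivative[OF z assms(1) per zero sum] by (auto intro!: derivative_eq_intros)
  qed
  then obtain C where "\<And>z. Im z > 0 \<Longrightarrow> eis_integral M h (?\<sigma> z) - eis_integral M h' z = C"
    using constant_on_upper_half_plane by blast
  then have "Im z > 0 \<Longrightarrow> eis_integral M h (?\<sigma> z) = eis_integral M h' z + C" for z
    by (simp add: diff_eq_eq add.commute)
  with per zero sum show ?thesis using that by blast
qed

text \<open>Invariance of the derivative leaves an unknown additive constant. It is found along the
  imaginary direction, where both integrals tend to 0.\<close>

lemma eis_integral_translate:
  assumes "M > 0" "periodic2 M h" "\<And>y. h 0 y = 0"
    and "(\<Sum>(x, y)\<in>{0..<M} \<times> {0..<M}. h x y) = 0"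
    and "\<And>x y. h x (y - x * w) = h x y" and "Im z > 0"
  shows "eis_integral M h (z + of_int w) = eis_integral M h z"
proof -
  have "((\<lambda>z. eis_integral M h (z + of_int w) - eis_integral M h z) has_field_derivative 0) (at z)" if z: "Im z > 0" for z
  proof -
    have "eisenstein M h (z + of_int w) = eisenstein M h z"
      using eisenstein_moebius[OF z, of 1 1 w 0, OF _ assms(1,2)] by (simp add: assms(5))
    moreover have "Im (z + of_int w) > 0" using z by simp
    ultimately have "(eis_integral M h has_field_derivative of_int M / (2 * pi * \<i>) * eisenstein M h z) (at (z + of_int w))"
      using eis_integral_has_field_derivative[OF _ assms(1-4), of "z + of_int w"] by simp
    then have "((\<lambda>z. eis_integral M h (z + of_int w)) has_field_derivative of_int M / (2 * pi * \<i>) * eisenstein M h z) (at z)"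
      by (simp add: DERIV_shift)
    then show ?thesis
      using eis_integral_has_field_derivative[OF z assms(1-4)] by (auto intro!: derivative_eq_intros)
  qed
  then obtain C where C: "\<And>z. Im z > 0 \<Longrightarrow> eis_integral M h (z + of_int w) - eis_integral M h z = C"
    using constant_on_upper_half_plane by blast
  have "((\<lambda>t. eis_integral M h (of_int w + \<i> * of_real t) - eis_integral M h (0 + \<i> * of_real t)) \<longlongrightarrow> 0 - 0) at_top"
    by (intro tendsto_diff eis_integral_tendsto_0 assms)
  moreover have "\<forall>\<^sub>F t in at_top. eis_integral M h (of_int w + \<i> * of_real t) - eis_integral M h (0 + \<i> * of_real t) = C"
    using eventually_gt_at_top[of 0] by eventually_elim (use C[of "\<i> * of_real _"] in \<open>simp add: add.commute\<close>)
  ultimately have "((\<lambda>t::real. C) \<longlongrightarrow> 0) at_top" using tendsto_cong by force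
  then have "C = 0" by (simp add: tendsto_const_iff)
  with C[OF assms(6)] show ?thesis by simp
qed

text \<open>The long assumption on \<open>h\<close> is invariance under (x, y) P^(-1), where P =
  sigma T^w sigma^(-1) and (a, c) is the first column of sigma. Carried over by sigma it becomes
  invariance of \<open>h'\<close> under translation by w.\<close>

theorem eis_integral_parabolic:
  assumes "M > 0" "periodic2 M h" "\<And>y. h 0 y = 0"
    and "(\<Sum>(x, y)\<in>{0..<M} \<times> {0..<M}. h x y) = 0"
    and "a * d - b * c = 1" "\<And>y. h (- (y * c)) (y * a) = 0"
    and "\<And>x y. h (x * (1 + w * a * c) + y * (w * c\<^sup>2)) (y * (1 - w * a * c) - x * (w * a\<^sup>2)) = h x y"
    and "Im z > 0"
  shows "eis_integral M h ((of_int a * (z + of_int w) + of_int b) / (of_int c * (z + of_int w) + of_int d)) =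
    eis_integral M h ((of_int a * z + of_int b) / (of_int c * z + of_int d))"
proof -
  define h' where "h' = (\<lambda>x y. h (x * d - y * c) (y * a - x * b))"
  obtain C where C: "\<And>z. Im z > 0 \<Longrightarrow>
    eis_integral M h ((of_int a * z + of_int b) / (of_int c * z + of_int d)) = eis_integral M h' z + C"
    and h': "periodic2 M h'" "\<And>y. h' 0 y = 0" "(\<Sum>(x, y)\<in>{0..<M} \<times> {0..<M}. h' x y) = 0"
    using eis_integral_moebius[OF assms(1-6)] unfolding h'_def by blast
  have "h' x (y - x * w) = h' x y" for x y
  proof -
    let ?X = "x * d - y * c" and ?Y = "y * a - x * b"
    have "x * d - (y - x * w) * c = ?X * (1 + w * a * c) + ?Y * (w * c\<^sup>2)"
      using assms(5) by algebra
    moreover have "(y - x * w) * a - x * b = ?Y * (1 - w * a * c) - ?X * (w * a\<^sup>2)"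
      using assms(5) by algebra
    ultimately show ?thesis unfolding h'_def by (simp only: assms(7))
  qed
  from eis_integral_translate[OF assms(1) h' this assms(8)] show ?thesis
    using C[OF assms(8)] C[of "z + of_int w"] assms(8) by simp
qed

subsection \<open>Characters and the newform weight\<close>

lemma e_of_int [simp]: "e (of_int n) = 1"
  using exp_integer_2pi[of "of_int n"] by (simp add: e_def mult_ac)

lemma e_eq_1_iff: "e (of_int k / of_int M) = 1 \<longleftrightarrow> M dvd k" if "M \<noteq> 0"
proof
  assume "e (of_int k / of_int M) = 1"
  then obtain n where "2 * pi * (real_of_int k / of_int M) = of_int (2 * n) * pi"
    unfolding e_def exp_eq_1 by (auto simp: Im_divide_of_int)
  then have "real_of_int k = of_int n * of_int M" using that by (simp add: field_simps)
  then have "k = n * M" by (metis of_int_eq_iff of_int_mult)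
  then show "M dvd k" by simp
next
  assume "M dvd k"
  then obtain n where "k = M * n" by (elim dvdE)
  then have "of_int k / of_int M = (of_int n :: complex)" using that by simp
  then show "e (of_int k / of_int M) = 1" by (simp only: e_of_int)
qed

lemma sum_e_residues:
  assumes "M > 0"
  shows "(\<Sum>y\<in>{0..<M}. e (of_int (k * y) / of_int M)) = (if M dvd k then of_int M else 0)"
proof -
  let ?w = "e (of_int k / of_int M)"
  have pow: "e (of_int (k * int n) / of_int M) = ?w ^ n" for n
    by (simp add: e_of_nat_mult[symmetric] mult.commute)
  have "(\<Sum>y\<in>{0..<M}. e (of_int (k * y) / of_int M)) = (\<Sum>n<nat M. ?w ^ n)"
    unfolding pow[symmetric]
    by (rule sum.reindex_bij_witness[of _ int nat]) (use assms in auto)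
  also have "\<dots> = (if M dvd k then of_int M else 0)"
  proof (cases "M dvd k")
    case True
    then have "?w = 1" using e_eq_1_iff assms by auto
    then show ?thesis using True assms by simp
  next
    case False
    then have "?w \<noteq> 1" using e_eq_1_iff assms by auto
    moreover have "?w ^ nat M = 1"
      unfolding pow[symmetric] using assms by simp
    ultimately show ?thesis using False by (simp add: sum_gp_strict)
  qed
  finally show ?thesis .
qed

lemma sum_residues_mult:
  fixes f :: "int \<Rightarrow> 'a :: comm_monoid_add"
  assumes "\<And>x. f (x + q) = f x" "coprime a q" "q > 0"
  shows "(\<Sum>t\<in>{0..<q}. f (a * t)) = (\<Sum>t\<in>{0..<q}. f t)"
proof -
  let ?g = "\<lambda>t. (a * t) mod q"
  have inj: "inj_on ?g {0..<q}"
  proof (rule inj_onI)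
    fix s t assume st: "s \<in> {0..<q}" "t \<in> {0..<q}" "?g s = ?g t"
    then have "[s = t] (mod q)"
      using assms(2) cong_mult_lcancel by (auto simp: cong_def[symmetric])
    then show "s = t" using st by (simp add: cong_def)
  qed
  have "?g ` {0..<q} = {0..<q}"
    by (rule endo_inj_surj) (use inj assms(3) in auto)
  then have "(\<Sum>t\<in>{0..<q}. f t) = (\<Sum>t\<in>{0..<q}. f (?g t))"
    using sum.reindex[OF inj, of f] by simp
  then show ?thesis using periodic_mod[of f, OF assms(1)] by simp
qed

section \<open>The finite Fourier transform of a character\<close>

text \<open>
  For primitive \<open>\<chi>\<close> this is a Gauss sum times \<open>\<chi>\<close>; working with the transform itself avoids
  showing that the Gauss sum is nonzero.
\<close>

definition dual_char :: "nat \<Rightarrow> (int \<Rightarrow> complex) \<Rightarrow> int \<Rightarrow> complex" where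
  "dual_char q chi y = (\<Sum>t\<in>{0..<int q}. cnj (chi t) * e (- (of_int (t * y) / of_int (int q))))"

lemma dirichlet_charD:
  assumes "dirichlet_char q chi"
  shows "q > 0" "chi (n + int q) = chi n" "chi (m * n) = chi m * chi n" "chi 1 = 1"
    "chi n = 0 \<longleftrightarrow> \<not> coprime n (int q)"
  using assms by (auto simp: dirichlet_char_def)

lemma dirichlet_char_cong:
  assumes "dirichlet_char q chi" "[m = n] (mod (int q))"
  shows "chi m = chi n"
  using assms(2) periodic_mod[of chi, OF dirichlet_charD(2)[OF assms(1)]] by (metis cong_def)

lemma dirichlet_char_minus_one:
  assumes "dirichlet_char q chi"
  shows "chi (- 1) = 1 \<or> chi (- 1) = - 1"
  using dirichlet_charD(3)[OF assms, of "- 1" "- 1"] dirichlet_charD(4)[OF assms]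
  by (simp add: square_eq_1_iff)

lemma e_cong:
  assumes "[m = n] (mod q)" "q \<noteq> 0"
  shows "e (of_int m / of_int q) = e (of_int n / of_int q)"
proof -
  obtain k where "m = n + q * k" using assms(1) by (metis cong_iff_lin cong_sym)
  then have "of_int m / of_int q = of_int n / of_int q + (of_int k :: complex)"
    using assms(2) by (simp add: field_simps)
  then show ?thesis by (simp only: e_add e_of_int mult_1_right)
qed

lemma dual_char_cong:
  assumes "[y = y'] (mod int q)" "q > 0"
  shows "dual_char q chi y = dual_char q chi y'"
proof -
  have "e (- (of_int (t * y) / of_int (int q))) = e (- (of_int (t * y') / of_int (int q)))" for t
    using e_cong[of "- (t * y)" "- (t * y')" "int q"] assms
    by (simp add: cong_minus_minus_iff cong_mult)
  then show ?thesis by (simp add: dual_char_def)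
qed

text \<open>Primitivity at the proper divisor d = q / gcd(y, q) supplies a unit a with a = 1 modulo
  d and chi(a) \<noteq> 1. Then a y = y modulo q, so replacing t by a t multiplies the transform by
  the conjugate of chi(a) without changing it.\<close>

lemma dual_char_eq_0:
  assumes "primitive_char q chi" "\<not> coprime y (int q)"
  shows "dual_char q chi y = 0"
proof -
  have dc: "dirichlet_char q chi" using assms(1) by (simp add: primitive_char_def)
  note D = dirichlet_charD[OF dc]
  define g where "g = gcd y (int q)"
  define d where "d = nat (int q div g)"
  have g: "g > 0" using D(1) by (simp add: g_def)
  have "g \<noteq> 1" using assms(2) by (simp add: g_def coprime_iff_gcd_eq_1)
  with g have g1: "g > 1" by simp
  have qg: "int q = g * int d" using D(1) g
    by (simp add: d_def g_def pos_imp_zdiv_nonneg_iff)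
  have "d > 0" using qg D(1) by (cases d) auto
  have "d dvd q" using qg by (metis dvd_triv_right int_dvd_int_iff)
  moreover have "d < q"
  proof -
    have "int d * 1 < int d * g" using g1 \<open>d > 0\<close> by (intro mult_strict_left_mono) auto
    then show ?thesis using qg by (simp add: mult.commute)
  qed
  ultimately obtain a where a: "[a = 1] (mod int d)" "coprime a (int q)" "chi a \<noteq> 1"
    using assms(1) unfolding primitive_char_def by blast
  have "g dvd y" by (simp add: g_def)
  then have "int q dvd (a - 1) * y"
    using a(1) unfolding qg cong_iff_dvd_diff by (simp add: mult.commute mult_dvd_mono)
  then have ay: "[a * y = y] (mod int q)" by (simp add: cong_iff_dvd_diff algebra_simps)
  let ?f = "\<lambda>t. cnj (chi t) * e (- (of_int (t * y) / of_int (int q)))"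
  have per: "?f (t + int q) = ?f t" for t
  proof -
    have "e (of_int (- ((t + int q) * y)) / of_int (int q)) = e (of_int (- (t * y)) / of_int (int q))"
      using D(1) by (intro e_cong) (simp_all add: cong_iff_dvd_diff algebra_simps)
    then show ?thesis by (simp add: D(2))
  qed
  have "dual_char q chi y = (\<Sum>t\<in>{0..<int q}. ?f (a * t))"
    unfolding dual_char_def using sum_residues_mult[of ?f, OF per a(2)] D(1) by simp
  also have "\<dots> = cnj (chi a) * dual_char q chi (a * y)"
    unfolding dual_char_def sum_distrib_left by (simp add: D(3) mult_ac)
  also have "dual_char q chi (a * y) = dual_char q chi y" by (rule dual_char_cong[OF ay D(1)])
  finally have "(1 - cnj (chi a)) * dual_char q chi y = 0" by (simp add: algebra_simps)
  moreover have "cnj (chi a) \<noteq> 1" using a(3) by (metis complex_cnj_cnj complex_cnj_one)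
  ultimately show ?thesis by simp
qed

lemma primitive_char_sum_eq_0:
  assumes "primitive_char q chi" "q \<noteq> 1"
  shows "(\<Sum>t\<in>{0..<int q}. chi t) = 0"
proof -
  have dc: "dirichlet_char q chi" using assms(1) by (simp add: primitive_char_def)
  note D = dirichlet_charD[OF dc]
  \<comment> \<open>For d = 1 the congruence is empty, so primitivity just says that the character
    is nonprincipal.\<close>
  have "1 dvd q \<and> 1 < q" using assms(2) D(1) by auto
  then obtain a where a: "coprime a (int q)" "chi a \<noteq> 1"
    using assms(1) unfolding primitive_char_def by (metis cong_1 of_nat_1)
  have "(\<Sum>t\<in>{0..<int q}. chi t) = (\<Sum>t\<in>{0..<int q}. chi (a * t))"
    using sum_residues_mult[of chi, OF D(2) a(1)] D(1) by simp
  also have "\<dots> = chi a * (\<Sum>t\<in>{0..<int q}. chi t)"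
    by (simp add: D(3) sum_distrib_left)
  finally have "(1 - chi a) * (\<Sum>t\<in>{0..<int q}. chi t) = 0" by (simp add: algebra_simps)
  with a(2) show ?thesis by simp
qed

text \<open>The transform has period q2 but is summed over the level q1 q2, so it contains only the
  frequencies t q1. Orthogonality leaves those beta divisible by q1; the minus sign in
  \<open>dual_char\<close> makes the argument beta / q1 come out positive.\<close>

lemma dual_char_inversion:
  assumes "dirichlet_char q2 chi" "q1 > 0"
  shows "(\<Sum>y\<in>{0..<int q1 * int q2}. dual_char q2 chi y * e (of_int (\<beta> * y) / of_int (int q1 * int q2))) =
    (if int q1 dvd \<beta> then of_int (int q1 * int q2) * cnj (chi (\<beta> div int q1)) else 0)"
proof -
  note D = dirichlet_charD[OF assms(1)]
  let ?M = "int q1 * int q2"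
  have M: "?M > 0" using D(1) assms(2) by simp
  have "(\<Sum>y\<in>{0..<?M}. dual_char q2 chi y * e (of_int (\<beta> * y) / of_int ?M)) =
     (\<Sum>y\<in>{0..<?M}. \<Sum>t\<in>{0..<int q2}. cnj (chi t) * e (of_int ((\<beta> - t * int q1) * y) / of_int ?M))"
    unfolding dual_char_def sum_distrib_right
  proof (intro sum.cong refl)
    fix y t
    have "of_int ((\<beta> - t * int q1) * y) / of_int ?M =
       - (of_int (t * y) / of_int (int q2)) + (of_int (\<beta> * y) / of_int ?M :: complex)"
      using assms(2) D(1) by (simp add: field_simps)
    then show "cnj (chi t) * e (- (of_int (t * y) / of_int (int q2))) * e (of_int (\<beta> * y) / of_int ?M) =
      cnj (chi t) * e (of_int ((\<beta> - t * int q1) * y) / of_int ?M)"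
      by (simp only: e_add mult.assoc)
  qed
  also have "\<dots> = (\<Sum>t\<in>{0..<int q2}. \<Sum>y\<in>{0..<?M}. cnj (chi t) * e (of_int ((\<beta> - t * int q1) * y) / of_int ?M))"
    by (rule sum.swap)
  also have "\<dots> = (\<Sum>t\<in>{0..<int q2}. cnj (chi t) * (if ?M dvd \<beta> - t * int q1 then of_int ?M else 0))"
    unfolding sum_distrib_left[symmetric] sum_e_residues[OF M] ..
  also have "\<dots> = (if int q1 dvd \<beta> then of_int ?M * cnj (chi (\<beta> div int q1)) else 0)"
  proof (cases "int q1 dvd \<beta>")
    case True
    then obtain b where b: "\<beta> = int q1 * b" by (elim dvdE)
    have "?M dvd \<beta> - t * int q1 \<longleftrightarrow> t = b mod int q2" if "t \<in> {0..<int q2}" for t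
    proof -
      have "\<beta> - t * int q1 = int q1 * (b - t)" by (simp add: b algebra_simps)
      then have "?M dvd \<beta> - t * int q1 \<longleftrightarrow> int q2 dvd b - t" using assms(2) by simp
      also have "\<dots> \<longleftrightarrow> t = b mod int q2" using that
        by (auto simp: mod_eq_dvd_iff[symmetric])
      finally show ?thesis .
    qed
    then have "(\<Sum>t\<in>{0..<int q2}. cnj (chi t) * (if ?M dvd \<beta> - t * int q1 then of_int ?M else 0)) =
       (\<Sum>t\<in>{0..<int q2}. if t = b mod int q2 then cnj (chi t) * of_int ?M else 0)"
      by (intro sum.cong) auto
    also have "\<dots> = cnj (chi (b mod int q2)) * of_int ?M"
      using D(1) by (subst sum.delta) auto
    also have "chi (b mod int q2) = chi b" by (rule periodic_mod[of chi, OF D(2)])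
    finally show ?thesis using True assms(2) by (simp add: b mult.commute)
  next
    case False
    have "\<not> ?M dvd \<beta> - t * int q1" for t
    proof
      assume "?M dvd \<beta> - t * int q1"
      then have "int q1 dvd \<beta> - t * int q1" by (rule dvd_mult_left)
      then have "int q1 dvd \<beta> - t * int q1 + t * int q1" by (intro dvd_add) auto
      then show False using False by simp
    qed
    then show ?thesis using False by simp
  qed
  finally show ?thesis .
qed

section \<open>The weight attached to the two characters, and its series\<close>

definition newform_weight :: "nat \<Rightarrow> (int \<Rightarrow> complex) \<Rightarrow> nat \<Rightarrow> (int \<Rightarrow> complex) \<Rightarrow> int \<Rightarrow> int \<Rightarrow> complex" where
  "newform_weight q1 chi1 q2 chi2 x y = (if int q2 dvd x then chi1 (x div int q2) * dual_char q2 chi2 y else 0)"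

lemma newform_weight_periodic:
  assumes "dirichlet_char q1 chi1" "dirichlet_char q2 chi2"
  shows "periodic2 (int q1 * int q2) (newform_weight q1 chi1 q2 chi2)"
proof -
  note D1 = dirichlet_charD[OF assms(1)] and D2 = dirichlet_charD[OF assms(2)]
  have "dual_char q2 chi2 (y + int q1 * int q2) = dual_char q2 chi2 y" for y
    by (rule dual_char_cong[OF _ D2(1)]) (simp add: cong_def)
  then show ?thesis using D2(1) by (simp add: periodic2_def newform_weight_def D1(2))
qed

lemma newform_weight_0:
  assumes "dirichlet_char q1 chi1" "q1 \<noteq> 1"
  shows "newform_weight q1 chi1 q2 chi2 0 y = 0"
  using dirichlet_charD(5)[OF assms(1), of 0] assms(2) by (simp add: newform_weight_def)

lemma newform_weight_sum:
  assumes "primitive_char q1 chi1" "q1 \<noteq> 1" "q2 > 0"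
  shows "(\<Sum>(x, y)\<in>{0..<int q1 * int q2} \<times> {0..<int q1 * int q2}. newform_weight q1 chi1 q2 chi2 x y) = 0"
proof -
  let ?M = "int q1 * int q2"
  have "(\<Sum>x\<in>{0..<?M}. newform_weight q1 chi1 q2 chi2 x y) = 0" for y
  proof -
    have "(\<Sum>x\<in>{0..<?M}. newform_weight q1 chi1 q2 chi2 x y) =
       (\<Sum>x\<in>{x \<in> {0..<?M}. int q2 dvd x}. chi1 (x div int q2) * dual_char q2 chi2 y)"
      unfolding newform_weight_def by (rule sum.inter_filter[symmetric]) simp
    also have "\<dots> = (\<Sum>t\<in>{0..<int q1}. chi1 t * dual_char q2 chi2 y)"
      by (rule sum.reindex_bij_witness[of _ "\<lambda>t. t * int q2" "\<lambda>x. x div int q2"])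
        (use assms(3) in \<open>auto elim!: dvdE simp: zero_le_mult_iff\<close>)
    also have "\<dots> = 0"
      by (simp add: sum_distrib_right[symmetric] primitive_char_sum_eq_0[OF assms(1,2)])
    finally show ?thesis .
  qed
  then show ?thesis by (simp add: sum.cartesian_product[symmetric] sum.swap[of _ "{0..<?M}"])
qed

text \<open>The parity condition makes the rows c and -c contribute equally, whence the factor 2;
  the conjugation is harmless there because chi2(-1) is 1 or -1.\<close>

lemma eis_coeff_newform_weight:
  assumes "dirichlet_char q1 chi1" "dirichlet_char q2 chi2" "chi1 (- 1) * chi2 (- 1) = 1"
  shows "eis_coeff (int q1 * int q2) (newform_weight q1 chi1 q2 chi2) c b =
    (if q2 dvd c \<and> q1 dvd b then
      2 * of_nat (q1 * q2) * chi1 (int (c div q2)) * cnj (chi2 (int (b div q1))) else 0)"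
proof -
  note D1 = dirichlet_charD[OF assms(1)] and D2 = dirichlet_charD[OF assms(2)]
  let ?M = "int q1 * int q2"
  have fc: "fourier_coeff ?M (newform_weight q1 chi1 q2 chi2) s c b =
     (if q2 dvd c \<and> q1 dvd b then chi1 (s * int (c div q2)) * (of_nat (q1 * q2) * cnj (chi2 (s * int (b div q1)))) else 0)"
    if "s \<in> {1, - 1}" for s
  proof (cases "q2 dvd c")
    case True
    then have c: "s * int c div int q2 = s * int (c div q2)" "int q2 dvd s * int c"
      using D2(1) by (auto elim!: dvdE)
    have "fourier_coeff ?M (newform_weight q1 chi1 q2 chi2) s c b =
      chi1 (s * int (c div q2)) * (\<Sum>y\<in>{0..<?M}. dual_char q2 chi2 y * e (of_int ((s * int b) * y) / of_int ?M))"
      unfolding fourier_coeff_def newform_weight_def using c by (simp add: sum_distrib_left mult_ac)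
    also have "\<dots> = chi1 (s * int (c div q2)) * (if int q1 dvd s * int b then of_int ?M * cnj (chi2 (s * int b div int q1)) else 0)"
      unfolding dual_char_inversion[OF assms(2) D1(1)] ..
    also have "(if int q1 dvd s * int b then of_int ?M * cnj (chi2 (s * int b div int q1)) else 0) =
       (if q1 dvd b then of_nat (q1 * q2) * cnj (chi2 (s * int (b div q1))) else 0)"
    proof (cases "q1 dvd b")
      case True
      then have "s * int b = int q1 * (s * int (b div q1))" by (auto elim!: dvdE)
      then have "s * int b div int q1 = s * int (b div q1)" "int q1 dvd s * int b"
        using D1(1) by (metis nonzero_mult_div_cancel_left of_nat_eq_0_iff less_not_refl, metis dvd_triv_left)
      then show ?thesis using True by simp
    next
      case False
      then have "\<not> int q1 dvd s * int b" using that by auto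
      then show ?thesis using False by simp
    qed
    finally show ?thesis using True by simp
  next
    case False
    then have "\<not> int q2 dvd s * int c" using that by auto
    then show ?thesis using False by (simp add: fourier_coeff_def newform_weight_def)
  qed
  have "chi1 (- 1) * cnj (chi2 (- 1)) = 1"
    using assms(3) dirichlet_char_minus_one[OF assms(2)] by auto
  moreover have "chi1 (- x) = chi1 (- 1) * chi1 x" "chi2 (- x) = chi2 (- 1) * chi2 x" for x
    using D1(3)[of "- 1" x] D2(3)[of "- 1" x] by simp_all
  ultimately have "chi1 (- x) * cnj (chi2 (- y)) = chi1 x * cnj (chi2 y)" for x y
    by (metis (no_types, lifting) complex_cnj_mult mult.assoc mult.left_commute mult_1)
  then show ?thesis
    unfolding eis_coeff_def by (simp add: fc)
qed

text \<open>A contributing divisor is c = q2 a with cofactor q1 (m / a). The q2 in 1/c cancels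
  against q1 q2 and leaves 2 q1, and for m = a b the normalisation agrees because sqrt(b/a) / sqrt(a
  b) = 1/a.\<close>

lemma divisor_coeff_newform_weight:
  assumes "dirichlet_char q1 chi1" "dirichlet_char q2 chi2" "chi1 (- 1) * chi2 (- 1) = 1"
  shows "\<not> q1 * q2 dvd n \<Longrightarrow>
      divisor_coeff (eis_coeff (int q1 * int q2) (newform_weight q1 chi1 q2 chi2)) n = 0"
    and "m > 0 \<Longrightarrow> divisor_coeff (eis_coeff (int q1 * int q2) (newform_weight q1 chi1 q2 chi2)) (q1 * q2 * m) =
      2 * of_nat q1 * (lam chi1 chi2 m / complex_of_real (sqrt (real m)))"
proof -
  note D1 = dirichlet_charD[OF assms(1)] and D2 = dirichlet_charD[OF assms(2)]
  let ?t = "\<lambda>n c. (if q2 dvd c \<and> q1 dvd n div c then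
      2 * of_nat (q1 * q2) * chi1 (int (c div q2)) * cnj (chi2 (int (n div c div q1))) else 0) / of_nat c"
  have dc: "divisor_coeff (eis_coeff (int q1 * int q2) (newform_weight q1 chi1 q2 chi2)) n = (\<Sum>c | c dvd n. ?t n c)" for n
    unfolding divisor_coeff_def eis_coeff_newform_weight[OF assms] ..
  show "divisor_coeff (eis_coeff (int q1 * int q2) (newform_weight q1 chi1 q2 chi2)) n = 0" if "\<not> q1 * q2 dvd n"
  proof -
    have "\<not> (q2 dvd c \<and> q1 dvd n div c)" if "c dvd n" for c
    proof
      assume "q2 dvd c \<and> q1 dvd n div c"
      then have "q2 * q1 dvd c * (n div c)" by (intro mult_dvd_mono) auto
      with that \<open>\<not> q1 * q2 dvd n\<close> show False by (simp add: mult.commute)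
    qed
    then show ?thesis unfolding dc by (intro sum.neutral) auto
  qed
  show "divisor_coeff (eis_coeff (int q1 * int q2) (newform_weight q1 chi1 q2 chi2)) (q1 * q2 * m) =
      2 * of_nat q1 * (lam chi1 chi2 m / complex_of_real (sqrt (real m)))" if m: "m > 0"
  proof -
    let ?n = "q1 * q2 * m"
    have n: "?n > 0" using m D1(1) D2(1) by simp
    have "(\<Sum>c | c dvd ?n. ?t ?n c) = (\<Sum>c\<in>{c. c dvd ?n \<and> q2 dvd c \<and> q1 dvd ?n div c}. ?t ?n c)"
      using n by (intro sum.mono_neutral_right) auto
    also have "\<dots> = (\<Sum>a | a dvd m. 2 * of_nat q1 * (chi1 (int a) * cnj (chi2 (int (m div a))) / of_nat a))"
    proof (rule sum.reindex_bij_witness[of _ "\<lambda>a. q2 * a" "\<lambda>c. c div q2"])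
      fix c assume "c \<in> {c. c dvd ?n \<and> q2 dvd c \<and> q1 dvd ?n div c}"
      then obtain a where a: "c = q2 * a" "q2 * a dvd ?n" "q1 dvd ?n div c" by (metis (lifting) dvdE mem_Collect_eq)
      then have "a > 0" using n by (intro Nat.gr0I) auto
      have "a dvd q1 * m" using a(2) D2(1) by (simp add: mult.assoc mult.left_commute[of q1])
      then have nd: "?n div c = q1 * m div a" using a(1) D2(1)
        by (simp add: mult.assoc mult.left_commute[of q1])
      have "a * q1 dvd q1 * m"
        using a(3) \<open>a dvd q1 * m\<close> unfolding nd by (metis dvd_mult_div_cancel mult_dvd_mono dvd_refl)
      then have "a dvd m" using D1(1) by (simp add: mult.commute)
      then obtain b where b: "m = a * b" by (elim dvdE)
      show "q2 * (c div q2) = c" "c div q2 \<in> {a. a dvd m}" using a(1) \<open>a dvd m\<close> D2(1) by auto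
      have "q1 * m div a = q1 * b" unfolding b using \<open>a > 0\<close> by (simp add: mult.left_commute)
      with nd have "?n div c = q1 * b" by simp
      then show "2 * of_nat q1 * (chi1 (int (c div q2)) * cnj (chi2 (int (m div (c div q2)))) / of_nat (c div q2)) = ?t ?n c"
        using a(1) D1(1) D2(1) b \<open>a > 0\<close> by (simp add: field_simps)
    next
      fix a assume "a \<in> {a. a dvd m}"
      then obtain b where b: "m = a * b" by (auto elim!: dvdE)
      then have "a > 0" using m by (intro Nat.gr0I) auto
      have "?n = (q2 * a) * (q1 * b)" by (simp add: b mult_ac)
      then show "q2 * a \<in> {c. c dvd ?n \<and> q2 dvd c \<and> q1 dvd ?n div c}"
        using \<open>a > 0\<close> D2(1) by (metis (no_types, lifting) dvd_triv_left mem_Collect_eq mult_pos_pos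
            nonzero_mult_div_cancel_left less_numeral_extra(3))
      show "q2 * a div q2 = a" using D2(1) by simp
    qed
    also have "\<dots> = 2 * of_nat q1 * (lam chi1 chi2 m / complex_of_real (sqrt (real m)))"
      unfolding lam_def sum_divide_distrib sum_distrib_left
    proof (intro sum.cong refl)
      fix a assume "a \<in> {a. a dvd m}"
      then obtain b where b: "m = a * b" by (auto elim!: dvdE)
      have ab: "a > 0" "b > 0" using m b by (auto intro: Nat.gr0I)
      have "sqrt (real b / real a) / sqrt (real m) = 1 / real a"
        using ab by (simp add: b real_sqrt_divide real_sqrt_mult)
      then have "complex_of_real (sqrt (real b / real a)) / complex_of_real (sqrt (real m)) = 1 / of_nat a"
        by (metis of_real_1 of_real_divide of_real_of_nat_eq)
      moreover have "m div a = b" using b ab by simp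
      ultimately show "2 * of_nat q1 * (chi1 (int a) * cnj (chi2 (int (m div a))) / of_nat a) =
        2 * of_nat q1 * (chi1 (int a) * cnj (chi2 (int (m div a))) * complex_of_real (sqrt (real (m div a) / real a)) /
          complex_of_real (sqrt (real m)))"
        by (simp only: times_divide_eq_right[symmetric] mult.assoc) simp
    qed
    finally show ?thesis unfolding dc .
  qed
qed

text \<open>Only exponents divisible by q1 q2 survive, and e(z/N)^(N m) = e(m z). As q1 \<noteq> 1
  there is no linear term, and the constant is c_0, which may be nonzero if q2 = 1.\<close>

lemma F_fun_eq_eis_integral:
  assumes "dirichlet_char q1 chi1" "dirichlet_char q2 chi2" "chi1 (- 1) * chi2 (- 1) = 1" "q1 \<noteq> 1"
  obtains C where "\<And>z. Im z > 0 \<Longrightarrow> F_fun q1 q2 chi1 chi2 z =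
    C + eis_integral (int q1 * int q2) (newform_weight q1 chi1 q2 chi2) z / (2 * of_nat q1)"
proof
  fix z :: complex assume z: "Im z > 0"
  note D1 = dirichlet_charD[OF assms(1)] and D2 = dirichlet_charD[OF assms(2)]
  let ?M = "int q1 * int q2"
  let ?a = "divisor_coeff (eis_coeff ?M (newform_weight q1 chi1 q2 chi2))"
  let ?q = "e (z / of_int ?M)"
  have M: "q1 * q2 > 0" using D1(1) D2(1) by simp
  have per: "periodic2 ?M (newform_weight q1 chi1 q2 chi2)" using assms by (intro newform_weight_periodic)
  obtain K where K: "\<And>c b. norm (eis_coeff ?M (newform_weight q1 chi1 q2 chi2) c b) \<le> K"
    using eis_coeff_bounded[OF per] M by auto
  have g: "strict_mono (\<lambda>n. q1 * q2 * (n + 1))" using M by (intro strict_monoI) simp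
  have zero: "?a n * ?q ^ n = 0" if "n \<notin> range (\<lambda>n. q1 * q2 * (n + 1))" for n
  proof (cases "q1 * q2 dvd n \<and> n > 0")
    case True
    then obtain k where k: "n = q1 * q2 * k" by (elim conjE dvdE)
    with True obtain j where "k = j + 1" by (cases k) auto
    with k that show ?thesis by blast
  next
    case False
    then show ?thesis using divisor_coeff_newform_weight(1)[OF assms(1-3)] by auto
  qed
  have coeff: "?a (q1 * q2 * (n + 1)) * ?q ^ (q1 * q2 * (n + 1)) =
     2 * of_nat q1 * (lam chi1 chi2 (n + 1) / complex_of_real (sqrt (real (n + 1))) * e (of_nat (n + 1) * z))" for n
  proof -
    have "of_nat (q1 * q2 * (n + 1)) * (z / of_int ?M) = of_nat (n + 1) * z"
      using D1(1) D2(1) by (simp add: field_simps)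
    then have "?q ^ (q1 * q2 * (n + 1)) = e (of_nat (n + 1) * z)"
      unfolding e_of_nat_mult[symmetric] by (simp only:)
    then show ?thesis using divisor_coeff_newform_weight(2)[OF assms(1-3), of "n + 1"] by simp
  qed
  have s: "summable (\<lambda>n. ?a n * ?q ^ n)"
    by (rule divisor_coeff_summable(2)[OF K]) (use z M in \<open>intro norm_e_less_1; simp\<close>)
  then have s': "summable (\<lambda>n. ?a (q1 * q2 * (n + 1)) * ?q ^ (q1 * q2 * (n + 1)))"
    using summable_mono_reindex[OF g, of "\<lambda>n. ?a n * ?q ^ n"] zero by blast
  have "eis_integral ?M (newform_weight q1 chi1 q2 chi2) z = (\<Sum>n. ?a (q1 * q2 * (n + 1)) * ?q ^ (q1 * q2 * (n + 1)))"
    unfolding eis_integral_def using suminf_mono_reindex[OF g, of "\<lambda>n. ?a n * ?q ^ n"] zero by simp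
  then have "eis_integral ?M (newform_weight q1 chi1 q2 chi2) z / (2 * of_nat q1) =
     (\<Sum>n. ?a (q1 * q2 * (n + 1)) * ?q ^ (q1 * q2 * (n + 1)) / (2 * of_nat q1))"
    using suminf_divide[OF s'] by simp
  also have "\<dots> = (\<Sum>n. lam chi1 chi2 (n + 1) / complex_of_real (sqrt (real (n + 1))) * e (of_nat (n + 1) * z))"
    unfolding coeff using D1(1) by simp
  finally show "F_fun q1 q2 chi1 chi2 z =
    (if q2 = 1 then L_at_1 chi1 / 2 else 0) + eis_integral ?M (newform_weight q1 chi1 q2 chi2) z / (2 * of_nat q1)"
    using assms(4) by (simp add: F_fun_def)
qed

subsection \<open>Vanishing at the cusp \<open>r/(Ru)\<close>\<close>

text \<open>A nonzero value makes both factors nonzero. The transform forces y p to be a unit modulo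
  q2, hence q2 | R; the value of chi1 then forces R / q2 to divide r as well, which is prime to R.
  So R = q2, the excluded case.\<close>

lemma newform_weight_vanishes_at_cusp:
  fixes q1 q2 Q R :: nat and r u g c p y :: int
  assumes "dirichlet_char q1 chi1" "primitive_char q2 chi2"
    and "q1 * q2 = Q * R" "Q > 0" "R > 0" "coprime Q R" "q2 \<noteq> R"
    and "coprime r (int R)" "coprime u (int Q)"
    and "c * g = int R * u" "p * g = r"
  shows "newform_weight q1 chi1 q2 chi2 (- (y * c)) (y * p) = 0"
proof (rule ccontr)
  have dc2: "dirichlet_char q2 chi2" using assms(2) by (simp add: primitive_char_def)
  note D1 = dirichlet_charD[OF assms(1)] and D2 = dirichlet_charD[OF dc2]
  assume "newform_weight q1 chi1 q2 chi2 (- (y * c)) (y * p) \<noteq> 0"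
  then have dvd: "int q2 dvd y * c" and chi: "chi1 (- (y * c) div int q2) \<noteq> 0" and dual: "dual_char q2 chi2 (y * p) \<noteq> 0"
    by (auto simp: newform_weight_def split: if_splits)
  have "coprime (y * p) (int q2)" using dual dual_char_eq_0[OF assms(2)] by blast
  then have y: "coprime y (int q2)" by simp
  then have "int q2 dvd c" using dvd by (simp add: coprime_commute coprime_dvd_mult_right_iff)
  then have q2Ru: "int q2 dvd int R * u" using assms(10) by (metis dvd_mult2)
  have "coprime (int R * u) (int Q)"
    using assms(6,9) by (simp add: coprime_commute)
  then have "coprime (int q2) (int Q)" by (rule coprime_divisors[OF q2Ru dvd_refl])
  moreover have "q2 dvd Q * R" using assms(3) by (metis dvd_triv_right)
  ultimately have "q2 dvd R" by (simp add: coprime_dvd_mult_right_iff)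
  \<comment> \<open>m = R / q2 = q1 / Q measures how far q2 is from R; what follows shows m =
    1.\<close>
  then obtain m where m: "R = q2 * m" by (elim dvdE)
  then have q1: "q1 = Q * m" using assms(3) D2(1) by (simp add: mult_ac)
  obtain k where k: "y * c = int q2 * k" using dvd by (elim dvdE)
  then have "- (y * c) div int q2 = - k" using D2(1) by (simp add: minus_mult_right del: mult_minus_right)
  then have "coprime k (int q1)" using chi D1(5)[of "- k"] by simp
  then have km: "coprime k (int m)" unfolding q1 by simp
  \<comment> \<open>Multiplying by g replaces c g by R u = q2 m u. Since m is prime to k, it must
    divide g, and therefore r = p g.\<close>
  have "int q2 * (k * g) = y * (c * g)" using k by (simp add: mult_ac)
  also have "\<dots> = int q2 * (y * int m * u)" unfolding assms(10) m by simp
  finally have "k * g = y * int m * u" using D2(1) by simp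
  then have "int m dvd k * g" by simp
  then have "int m dvd g" using km by (simp add: coprime_commute coprime_dvd_mult_right_iff)
  then have "int m dvd r" using assms(11) by (metis dvd_mult)
  moreover have "int m dvd int R" unfolding m by simp
  ultimately have "is_unit (int m)" using assms(8) by (metis coprime_common_divisor)
  then have "m = 1" by simp
  then show False using m assms(7) by simp
qed

lemma F_fun_translate:
  assumes "q1 \<noteq> 1"
  shows "F_fun q1 q2 chi1 chi2 (z + of_int m) = F_fun q1 q2 chi1 chi2 z"
proof -
  have "e (of_nat n * (z + of_int m)) = e (of_nat n * z)" for n
  proof -
    have "of_nat n * (z + of_int m) = of_nat n * z + of_int (int n * m)" by (simp add: distrib_left)
    then show ?thesis by (simp only: e_add e_of_int mult_1_right)
  qed
  then show ?thesis using assms by (simp only: F_fun_def) simp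
qed

lemma F_fun_invariant:
  fixes q1 q2 Q R :: nat and r u k s b d :: int
  assumes "primitive_char q1 chi1" "primitive_char q2 chi2"
    and "chi1 (- 1) * chi2 (- 1) = 1" "q1 \<noteq> 1"
    and "q1 * q2 = Q * R" "Q > 0" "R > 0" "coprime Q R" "q2 \<noteq> R"
    and "coprime r (int R)" "coprime u (int Q)"
    and s: "s \<in> {1, - 1}"
  defines "A \<equiv> s + int (q1 * q2) * k * u * r" and "C \<equiv> int (q1 * q2) * int R * k * u\<^sup>2"
  assumes det: "A * d - b * C = 1" and z: "Im z > 0"
  shows "F_fun q1 q2 chi1 chi2 (moebius_act (A, b, C, d) z) = F_fun q1 q2 chi1 chi2 z"
proof -
  have dc1: "dirichlet_char q1 chi1" and dc2: "dirichlet_char q2 chi2"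
    using assms(1,2) by (auto simp: primitive_char_def)
  note D1 = dirichlet_charD[OF dc1] and D2 = dirichlet_charD[OF dc2]
  define N where "N = int q1 * int q2"
  have N: "N > 0" "N = int Q * int R"
    using D1(1) D2(1) arg_cong[OF assms(5), of int] assms(6,7) by (simp_all add: N_def)
  define h where "h = newform_weight q1 chi1 q2 chi2"
  have per: "periodic2 N h" unfolding h_def N_def by (rule newform_weight_periodic[OF dc1 dc2])
  have zero: "h 0 y = 0" for y unfolding h_def by (rule newform_weight_0[OF dc1 assms(4)])
  have sum0: "(\<Sum>(x, y)\<in>{0..<N} \<times> {0..<N}. h x y) = 0"
    unfolding h_def N_def by (rule newform_weight_sum[OF assms(1,4) D2(1)])
  \<comment> \<open>The cusp must not be 0/0: r = u = 0 would give R = Q = 1 and so q1 = 1.\<close>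
  have "r \<noteq> 0 \<or> int R * u \<noteq> 0"
  proof (rule ccontr)
    assume "\<not> (r \<noteq> 0 \<or> int R * u \<noteq> 0)"
    then have "r = 0" "u = 0" using assms(7) by auto
    then have "R = 1" "Q = 1" using assms(10,11) by auto
    then show False using assms(4,5) by simp
  qed
  \<comment> \<open>r is prime to R but may share factors with u, so r/(Ru) is reduced before it is
    completed to a matrix.\<close>
  define g where "g = gcd r (int R * u)"
  have g: "g \<noteq> 0" using \<open>r \<noteq> 0 \<or> int R * u \<noteq> 0\<close> by (simp add: g_def)
  define p where "p = r div g"
  define c where "c = (int R * u) div g"
  have pg: "p * g = r" and cg: "c * g = int R * u" by (simp_all add: p_def c_def g_def)
  have "coprime p c" unfolding p_def c_def g_def
    using \<open>r \<noteq> 0 \<or> int R * u \<noteq> 0\<close> by (intro div_gcd_coprime) auto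
  then obtain v t where vt: "v * p + t * c = 1"
    using bezout_int[of p c] by (auto simp: coprime_iff_gcd_eq_1)
  \<comment> \<open>Solved from the first column of P: since p g = r, c g = R u and N = Q R, this w
    yields w p c = -s N k u r and w c^2 = -s C.\<close>
  define w where "w = - (s * int Q * k * g\<^sup>2)"
  have wpc: "w * p * c = - (s * N * k * u * r)"
  proof -
    have "w * p * c = - (s * int Q * k * (p * g) * (c * g))" by (simp add: w_def power2_eq_square)
    then show ?thesis by (simp add: pg cg N(2))
  qed
  have wcc: "w * c\<^sup>2 = - (s * C)"
  proof -
    have "w * c\<^sup>2 = - (s * int Q * k * (c * g)\<^sup>2)" by (simp add: w_def power_mult_distrib)
    moreover have "C = N * int R * k * u\<^sup>2" by (simp add: C_def N_def)
    ultimately show ?thesis by (simp add: cg N(2) power2_eq_square)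
  qed
  have A: "s * A = 1 - w * p * c"
    using s unfolding wpc A_def N_def by auto
  \<comment> \<open>Multiples of N are removed by periodicity. The remaining shift x w p^2 matters
    only if q2 | x, and then it is 0 modulo the period q2 of the transform.\<close>
  have inv: "h (x * (1 + w * p * c) + y * (w * c\<^sup>2)) (y * (1 - w * p * c) - x * (w * p\<^sup>2)) = h x y" for x y
  proof -
    have "C = N * (int R * k * u\<^sup>2)" by (simp add: C_def N_def)
    then have "x * (1 + w * p * c) + y * (w * c\<^sup>2) = x + N * (- (x * s * k * u * r) - y * s * int R * k * u\<^sup>2)"
      unfolding wpc wcc by (simp add: algebra_simps)
    moreover have "y * (1 - w * p * c) - x * (w * p\<^sup>2) = y - x * (w * p\<^sup>2) + N * (y * s * k * u * r)"
      unfolding wpc by (simp add: algebra_simps)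
    ultimately have "h (x * (1 + w * p * c) + y * (w * c\<^sup>2)) (y * (1 - w * p * c) - x * (w * p\<^sup>2)) = h x (y - x * (w * p\<^sup>2))"
      by (simp only: periodic2_add_mult[OF per])
    also have "\<dots> = h x y"
    proof (cases "int q2 dvd x")
      case True
      then have "[y - x * (w * p\<^sup>2) = y] (mod int q2)" by (simp add: cong_iff_dvd_diff)
      then show ?thesis unfolding h_def newform_weight_def using dual_char_cong[OF _ D2(1)] by simp
    qed (simp add: h_def newform_weight_def)
    finally show ?thesis .
  qed
  have cusp: "h (- (y * c)) (y * p) = 0" for y
    unfolding h_def by (rule newform_weight_vanishes_at_cusp[OF dc1 assms(2,5-11) cg pg])
  obtain K where F: "\<And>z. Im z > 0 \<Longrightarrow> F_fun q1 q2 chi1 chi2 z = K + eis_integral N h z / (2 * of_nat q1)"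
    using F_fun_eq_eis_integral[OF dc1 dc2 assms(3,4)] unfolding N_def h_def by blast
  \<comment> \<open>The upper right entry of P^(-1) times s gamma. That product is a translation
    because the first columns agree.\<close>
  define m where "m = (1 + w * p * c) * (s * b) - w * p\<^sup>2 * (s * d)"
  have ss: "s * s = 1" using s by auto
  define a' where "a' = s * A"
  define b' where "b' = s * b"
  define c' where "c' = s * C"
  define d' where "d' = s * d"
  have det': "a' * d' - b' * c' = 1"
  proof -
    have "a' * d' - b' * c' = s * s * (A * d - b * C)" by (simp add: a'_def b'_def c'_def d'_def algebra_simps)
    then show ?thesis by (simp add: ss det)
  qed
  have a': "a' = 1 - w * p * c" and c': "c' = - (w * c\<^sup>2)" using A wcc by (simp_all add: a'_def c'_def)
  have b': "b' = a' * m + w * p\<^sup>2" and d': "d' = c' * m + (1 + w * p * c)"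
    using det' unfolding m_def a' c' b'_def[symmetric] d'_def[symmetric] by algebra+
  define Z where "Z = z + of_int m"
  have Z: "Im Z > 0" using z by (simp add: Z_def)
  have det2: "p * v - (- t) * c = 1" using vt by (simp add: mult.commute)
  have det3: "v * p - t * (- c) = 1" using vt by simp
  \<comment> \<open>y = sigma^(-1) Z, so that P Z = sigma (y + w), while gamma z = P Z.\<close>
  define y where "y = (of_int v * Z + of_int t) / (of_int (- c) * Z + of_int p)"
  have y: "Im y > 0" unfolding y_def by (rule Im_moebius_pos[OF Z det3])
  have j: "of_int (- c) * Z + of_int p \<noteq> 0" by (rule moebius_denominator_nonzero[OF Z det3])
  let ?\<sigma> = "\<lambda>y. (of_int p * y + of_int (- t)) / (of_int c * y + of_int v)"
  have vt': "of_int v * of_int p + of_int t * of_int c = (1 :: complex)"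
    using arg_cong[OF vt, of of_int] by simp
  \<comment> \<open>W is left general because two values are needed: W = 0 gives sigma y = Z, and W
    = w gives the image under P.\<close>
  have num: "of_int p * (y + W) + of_int (- t) = (Z + of_int p * W * (of_int (- c) * Z + of_int p)) / (of_int (- c) * Z + of_int p)"
    and den: "of_int c * (y + W) + of_int v = (1 + of_int c * W * (of_int (- c) * Z + of_int p)) / (of_int (- c) * Z + of_int p)" for W
  proof -
    let ?j = "of_int (- c) * Z + of_int p"
    have yj: "y * ?j = of_int v * Z + of_int t" using j by (simp add: y_def)
    have "(of_int p * (y + W) + of_int (- t)) * ?j = of_int p * (y * ?j) + of_int p * W * ?j - of_int t * ?j"
      by (simp add: algebra_simps)
    also have "\<dots> = (of_int v * of_int p + of_int t * of_int c) * Z + of_int p * W * ?j"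
      unfolding yj by (simp add: algebra_simps)
    finally show "of_int p * (y + W) + of_int (- t) = (Z + of_int p * W * ?j) / ?j"
      using j by (simp add: vt' eq_divide_eq)
    have "(of_int c * (y + W) + of_int v) * ?j = of_int c * (y * ?j) + of_int c * W * ?j + of_int v * ?j"
      by (simp add: algebra_simps)
    also have "\<dots> = (of_int v * of_int p + of_int t * of_int c) + of_int c * W * ?j"
      unfolding yj by (simp add: algebra_simps)
    finally show "of_int c * (y + W) + of_int v = (1 + of_int c * W * ?j) / ?j"
      using j by (simp add: vt' eq_divide_eq)
  qed
  have \<sigma>y: "?\<sigma> y = Z" using num[of 0] den[of 0] j by simp
  have quot: "(a / k) / (b / k) = a / b" if "k \<noteq> 0" for a b k :: complex
    using that by simp
  have "moebius_act (A, b, C, d) z = (of_int a' * z + of_int b') / (of_int c' * z + of_int d')"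
  proof -
    have "of_int a' * z + of_int b' = of_int s * (of_int A * z + of_int b)"
      "of_int c' * z + of_int d' = of_int s * (of_int C * z + of_int d)"
      by (simp_all add: a'_def b'_def c'_def d'_def algebra_simps)
    then show ?thesis using s by (auto simp: moebius_act_def)
  qed
  also have "of_int a' * z + of_int b' = Z + of_int p * of_int w * (of_int (- c) * Z + of_int p)"
  proof -
    have "of_int a' = (1 - of_int w * of_int p * of_int c :: complex)" by (simp add: a')
    moreover have "of_int b' = (of_int a' * of_int m + of_int w * (of_int p)\<^sup>2 :: complex)" by (simp add: b')
    ultimately show ?thesis unfolding Z_def of_int_minus by algebra
  qed
  also have "of_int c' * z + of_int d' = 1 + of_int c * of_int w * (of_int (- c) * Z + of_int p)"
  proof -
    have "of_int c' = (- (of_int w * (of_int c)\<^sup>2) :: complex)" by (simp add: c')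
    moreover have "of_int d' = (of_int c' * of_int m + (1 + of_int w * of_int p * of_int c) :: complex)" by (simp add: d')
    ultimately show ?thesis unfolding Z_def of_int_minus by algebra
  qed
  finally have \<gamma>: "moebius_act (A, b, C, d) z = ?\<sigma> (y + of_int w)"
    unfolding num den quot[OF j] .
  have yw: "Im (y + of_int w) > 0" using y by simp
  have "Im (?\<sigma> (y + of_int w)) > 0" by (rule Im_moebius_pos[OF yw det2])
  then have "F_fun q1 q2 chi1 chi2 (moebius_act (A, b, C, d) z) = K + eis_integral N h (?\<sigma> (y + of_int w)) / (2 * of_nat q1)"
    unfolding \<gamma> by (rule F)
  also have "eis_integral N h (?\<sigma> (y + of_int w)) = eis_integral N h (?\<sigma> y)"
    by (rule eis_integral_parabolic[where h = h and a = p and c = c and w = w, OF N(1) per zero sum0 det2 cusp inv y])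
  also have "K + eis_integral N h (?\<sigma> y) / (2 * of_nat q1) = F_fun q1 q2 chi1 chi2 Z"
    unfolding \<sigma>y by (rule F[OF Z, symmetric])
  also have "\<dots> = F_fun q1 q2 chi1 chi2 z" unfolding Z_def by (rule F_fun_translate[OF assms(4)])
  finally show ?thesis .
qed

theorem theorem1p3:
  fixes chi1 chi2 :: "int \<Rightarrow> complex" and q1 q2 Q R :: nat and r u k :: int
  assumes "primitive_char q1 chi1" and "primitive_char q2 chi2"
    and "chi1 (-1) * chi2 (-1) = 1"
    and "q1 * q2 > 1"
    and "q1 * q2 = Q * R" and "Q > 0" and "R > 0" and "coprime Q R"
    and "q1 \<noteq> 1" and "q2 \<noteq> R"
    and "coprime r (int R)" and "coprime u (int Q)"
  shows "\<forall>s\<in>{1, -1::int}. \<forall>b d.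
           in_Gamma0 (q1 * q2)
             (s + int (q1 * q2) * k * u * r, b, int (q1 * q2) * int R * k * u^2, d) \<longrightarrow>
           newform_dedekind_sum q1 q2 chi1 chi2
             (s + int (q1 * q2) * k * u * r, b, int (q1 * q2) * int R * k * u^2, d) = 0"
proof (intro ballI allI impI)
  fix s b d :: int
  let ?A = "s + int (q1 * q2) * k * u * r" and ?C = "int (q1 * q2) * int R * k * u^2"
  assume s: "s \<in> {1, - 1}" and "in_Gamma0 (q1 * q2) (?A, b, ?C, d)"
  then have det: "?A * d - b * ?C = 1" by (simp add: in_Gamma0_def)
  have dc1: "dirichlet_char q1 chi1" and dc2: "dirichlet_char q2 chi2"
    using assms(1,2) by (auto simp: primitive_char_def)
  \<comment> \<open>Modulo N the determinant reads s d = 1, so d = s. For s = -1 the parity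
    condition gives the value 1.\<close>
  have psi: "psi_char chi1 chi2 (?A, b, ?C, d) = 1"
  proof -
    have "s * d - 1 = int q1 * int q2 * (b * int R * k * u\<^sup>2 - k * u * r * d)"
      using det by (simp add: algebra_simps)
    moreover have "s * (s * d - 1) = d - s" using s by auto
    ultimately have "d - s = int q1 * int q2 * (s * (b * int R * k * u\<^sup>2 - k * u * r * d))"
      by (metis mult.left_commute)
    then have "[d = s] (mod int q1)" "[d = s] (mod int q2)" by (simp_all add: cong_iff_dvd_diff)
    then have "chi1 d = chi1 s" "chi2 d = chi2 s"
      using dirichlet_char_cong dc1 dc2 by blast+
    then show ?thesis
      using s assms(3) dirichlet_charD(4)[OF dc1] dirichlet_charD(4)[OF dc2] dirichlet_char_minus_one[OF dc2]
      by (auto simp: psi_char_def)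
  qed
  have "F_fun q1 q2 chi1 chi2 (moebius_act (?A, b, ?C, d) z) - psi_char chi1 chi2 (?A, b, ?C, d) * F_fun q1 q2 chi1 chi2 z = 0"
    if "Im z > 0" for z
    using F_fun_invariant[OF assms(1-3,9,5-8,10-12) s det that] psi by simp
  \<comment> \<open>Uniqueness in the \<open>THE\<close> needs one point of the half plane; i is
    taken.\<close>
  then have "phi_fun q1 q2 chi1 chi2 (?A, b, ?C, d) = 0"
    unfolding phi_fun_def by (intro the_equality) (auto dest!: spec[of _ \<i>])
  then show "newform_dedekind_sum q1 q2 chi1 chi2 (?A, b, ?C, d) = 0"
    by (simp add: newform_dedekind_sum_def)
qed

end
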